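(* Let $p$ be an odd prime. If $\alpha\in\mathbb{Q}_p$ has a purely periodic continued fraction expansion $\alpha=[\overline{b_0,\ldots,b_{k-1}}]$ produced by the algorithm Browkin II, then $$|\alpha|_p=1,\qquad |\overline{\alpha}|_p<1,$$ where $\overline{\alpha}$ is the conjugate of $\alpha$.
   Context: Let $p$ be an odd prime, and let $v_p$, $|\cdot|_p$ be the $p$-adic valuation and norm on $\mathbb{Q}_p$. Every $\alpha\in\mathbb{Q}_p$ is written uniquely as $\alpha=\sum_{n=-r}^{+\infty}a_np^n$ with $r\in\mathbb{Z}$ and digits $a_n\in\{-\frac{p-1}{2},\ldots,\frac{p-1}{2}\}$. Define $s(\alpha)=\sum_{n=-r}^{0}a_np^n\in\mathbb{Q}$ and $t(\alpha)=\sum_{n=-r}^{-1}a_np^n\in\mathbb{Q}$ (empty sums are $0$), and let $\mathrm{sign}$ be the usual sign function on $\mathbb{Q}$. The algorithm Browkin II, started at $\alpha_0=\alpha\in\mathbb{Q}_p$, computes for $n\ge 0$: $b_n=s(\alpha_n)$ if $n$ is even; $b_n=t(\alpha_n)$ if $n$ is odd and $v_p(\alpha_n-t(\alpha_n))=0$; $b_n=t(\alpha_n)-\mathrm{sign}(t(\alpha_n))$ if $n$ is odd and $v_p(\alpha_n-t(\alpha_n))\neq 0$; and $\alpha_{n+1}=\frac{1}{\alpha_n-b_n}$ (stopping if $\alpha_n=b_n$). The sequence $[b_0,b_1,\ldots]$ is the Browkin II expansion of $\alpha$. It is purely periodic, written $[\overline{b_0,\ldots,b_{k-1}}]$, if it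 is infinite and $b_{n+k}=b_n$ for all $n\ge 0$ (with $k\geq 1$). If $\alpha\in\mathbb{Q}_p$ has a periodic expansion, it is a root of an irreducible polynomial of degree $2$ over $\mathbb{Q}$; its conjugate $\overline{\alpha}\in\mathbb{Q}_p$ is the other root of this polynomial. *)

theory Defs
  imports
    "HOL-Library.Cardinality"
    "HOL-Computational_Algebra.Computational_Algebra"
begin

section \<open>The field of $p$-adic numbers\<close>

text \<open>
  The prime \<open>p\<close> is the cardinality of an index type \<open>'p\<close>, so that \<open>\<int>\<^sub>p\<close> and \<open>\<rat>\<^sub>p\<close> are types.
  Every prime is the cardinality of some type (for instance of a numeral type), so quantifying over
  \<open>'p :: prime_card\<close> is quantifying over all primes.
\<close>

class prime_card = finite +
  assumes prime_card: "prime CARD('a)"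

abbreviation pr :: "'p::prime_card itself \<Rightarrow> int" where
  "pr TYPE('p) \<equiv> int CARD('p)"

lemma prime_pr: "prime (pr TYPE('p::prime_card))"
  by (simp add: prime_card)

lemma pr_gt_1: "pr TYPE('p::prime_card) > 1"
  using prime_gt_1_int[OF prime_pr] .

text \<open>\<open>\<int>\<^sub>p\<close> as the inverse limit of the rings \<open>\<int>/p\<^sup>n\<int>\<close>, with residues in \<open>{0..<p\<^sup>n}\<close>.\<close>

typedef (overloaded) 'p::prime_card padic_int =
  "{x :: nat \<Rightarrow> int. \<forall>n. x (Suc n) mod pr TYPE('p) ^ n = x n}"
  morphisms residue Abs_padic_int
  by (rule exI[of _ "\<lambda>_. 0"]) simp

setup_lifting type_definition_padic_int

lemma mod_Suc_power_mod: "(a mod p ^ Suc n) mod p ^ n = (a mod p ^ n :: int)"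
  by (rule mod_mod_cancel) simp

instantiation padic_int :: (prime_card) comm_ring_1
begin

lift_definition zero_padic_int :: "'a padic_int" is "\<lambda>_. 0" by simp

lift_definition one_padic_int :: "'a padic_int" is "\<lambda>n. 1 mod pr TYPE('a) ^ n"
  by (simp only: mod_Suc_power_mod)

lift_definition plus_padic_int :: "'a padic_int \<Rightarrow> 'a padic_int \<Rightarrow> 'a padic_int"
  is "\<lambda>x y n. (x n + y n) mod pr TYPE('a) ^ n"
  by (simp only: mod_Suc_power_mod) (metis mod_add_eq mod_mod_trivial)

lift_definition minus_padic_int :: "'a padic_int \<Rightarrow> 'a padic_int \<Rightarrow> 'a padic_int"
  is "\<lambda>x y n. (x n - y n) mod pr TYPE('a) ^ n"
  by (simp only: mod_Suc_power_mod) (metis mod_diff_eq mod_mod_trivial)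

lift_definition uminus_padic_int :: "'a padic_int \<Rightarrow> 'a padic_int"
  is "\<lambda>x n. (- x n) mod pr TYPE('a) ^ n"
  by (simp only: mod_Suc_power_mod) (metis mod_minus_eq mod_mod_trivial)

lift_definition times_padic_int :: "'a padic_int \<Rightarrow> 'a padic_int \<Rightarrow> 'a padic_int"
  is "\<lambda>x y n. (x n * y n) mod pr TYPE('a) ^ n"
  by (simp only: mod_Suc_power_mod) (metis mod_mult_eq mod_mod_trivial)

instance
proof
  fix a b c :: "'a padic_int"
  show "a * b * c = a * (b * c)"
    by transfer (simp add: mod_mult_left_eq mod_mult_right_eq mult.assoc)
  show "a * b = b * a"
    by transfer (simp add: mult.commute)
  show "1 * a = a"
    by transfer (auto simp: mod_mult_left_eq fun_eq_iff, metis mod_mod_trivial)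
  show "a + b + c = a + (b + c)"
    by transfer (simp add: mod_add_left_eq mod_add_right_eq add.assoc)
  show "a + b = b + a"
    by transfer (simp add: add.commute)
  show "0 + a = a"
    by transfer (auto simp: fun_eq_iff, metis mod_mod_trivial)
  show "- a + a = 0"
    by transfer (simp add: mod_add_left_eq)
  show "a - b = a + - b"
    by transfer (simp add: mod_add_right_eq)
  show "(a + b) * c = a * c + b * c"
    by transfer (simp only: mod_mult_left_eq mod_add_eq distrib_right)
  show "(0::'a padic_int) \<noteq> 1"
  proof
    assume "(0::'a padic_int) = 1"
    then have "residue (0::'a padic_int) 1 = residue (1::'a padic_int) 1" by simp
    then show False using pr_gt_1[where 'p='a] by transfer simp
  qed
qed

end

lemma residue_eqI: "(\<And>n. residue x n = residue y n) \<Longrightarrow> x = y"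
  by (simp add: residue_inject[symmetric] fun_eq_iff)

lemma residue_Suc_mod: "residue (x :: 'p::prime_card padic_int) (Suc n) mod pr TYPE('p) ^ n = residue x n"
  by transfer simp

lemma residue_mod: 
  "m \<le> n \<Longrightarrow> residue (x :: 'p::prime_card padic_int) n mod pr TYPE('p) ^ m = residue x m"
proof (induction n rule: dec_induct)
  case base
  show ?case by (metis residue_Suc_mod mod_mod_trivial)
next
  case (step n)
  have "residue x (Suc n) mod pr TYPE('p) ^ m
      = (residue x (Suc n) mod pr TYPE('p) ^ n) mod pr TYPE('p) ^ m"
    using step.hyps by (simp add: mod_mod_cancel le_imp_power_dvd)
  then show ?case using step.IH by (simp add: residue_Suc_mod)
qed

lemma residue_zero [simp]: "residue 0 n = 0"
  by transfer simp

lemma residue_add: "residue (x + y) n = (residue x n + residue y n) mod pr TYPE('p) ^ n"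
  for x y :: "'p::prime_card padic_int"
  by transfer simp

lemma residue_diff: "residue (x - y) n = (residue x n - residue y n) mod pr TYPE('p) ^ n"
  for x y :: "'p::prime_card padic_int"
  by transfer simp

lemma residue_mult: "residue (x * y) n = (residue x n * residue y n) mod pr TYPE('p) ^ n"
  for x y :: "'p::prime_card padic_int"
  by transfer simp

lemma residue_of_nat: "residue (of_nat m :: 'p::prime_card padic_int) n = int m mod pr TYPE('p) ^ n"
proof (induction m)
  case (Suc m)
  have "residue (1 :: 'p padic_int) n = 1 mod pr TYPE('p) ^ n" by transfer simp
  then show ?case using Suc by (simp add: residue_add mod_add_eq)
qed simp

lemma residue_of_int: "residue (of_int m :: 'p::prime_card padic_int) n = m mod pr TYPE('p) ^ n"
proof (cases m)
  case (nonneg k)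
  then show ?thesis by (simp add: residue_of_nat)
next
  case (neg k)
  have "of_int m = (0 - of_nat (Suc k) :: 'p padic_int)"
    unfolding neg by (simp only: of_int_minus of_int_of_nat_eq diff_0)
  then have "residue (of_int m :: 'p padic_int) n = (0 - int (Suc k) mod pr TYPE('p) ^ n) mod pr TYPE('p) ^ n"
    by (simp only: residue_diff residue_of_nat residue_zero)
  then show ?thesis unfolding neg by (simp only: mod_minus_eq diff_0)
qed

text \<open>The valuation on \<open>\<int>\<^sub>p\<close>; it is not meaningful at \<open>0\<close>.\<close>

definition val_int :: "'p::prime_card padic_int \<Rightarrow> nat" where
  "val_int x = (LEAST n. residue x (Suc n) \<noteq> 0)"

lemma residue_eq_0_iff:
  fixes x :: "'p::prime_card padic_int"
  assumes "x \<noteq> 0"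
  shows "residue x n = 0 \<longleftrightarrow> n \<le> val_int x"
proof -
  obtain m where m: "residue x m \<noteq> 0"
    using assms residue_eqI[of x 0] by auto
  have "residue x 0 = 0" by (metis residue_Suc_mod power_0 mod_by_1)
  with m obtain m' where "residue x (Suc m') \<noteq> 0" by (cases m) auto
  then have *: "residue x (Suc (val_int x)) \<noteq> 0" unfolding val_int_def by (rule LeastI)
  have le: "residue x j = 0" if "residue x i = 0" "j \<le> i" for i j
    using residue_mod[OF that(2), of x] that(1) by simp
  have "residue x (val_int x) = 0"
  proof (cases "val_int x")
    case 0
    then show ?thesis using \<open>residue x 0 = 0\<close> by simp
  next
    case (Suc k)
    then have "k < (LEAST n. residue x (Suc n) \<noteq> 0)" by (simp add: val_int_def)
    from not_less_Least[OF this] Suc show ?thesis by simp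
  qed
  then show ?thesis using * le[of n "Suc (val_int x)"] le[of "val_int x" n] by (cases "n \<le> val_int x") auto
qed

lemma residue_eq_0_iff_dvd:
  "m \<le> n \<Longrightarrow> residue (x :: 'p::prime_card padic_int) m = 0 \<longleftrightarrow> pr TYPE('p) ^ m dvd residue x n"
  using residue_mod[of m n x] by (simp add: dvd_eq_mod_eq_0)

lemma val_int_eqI:
  assumes "residue x n = 0" "residue x (Suc n) \<noteq> 0"
  shows "val_int x = n"
  using assms residue_eq_0_iff[of x n] residue_eq_0_iff[of x "Suc n"] by (cases "x = 0") auto

lemma val_int_mult_aux:
  fixes x y :: "'p::prime_card padic_int"
  assumes "x \<noteq> 0" "y \<noteq> 0"
  shows "residue (x * y) (val_int x + val_int y) = 0"
    and "residue (x * y) (Suc (val_int x + val_int y)) \<noteq> 0"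
proof -
  define p a b where "p = pr TYPE('p)" and "a = val_int x" and "b = val_int y"
  define N where "N = Suc (a + b)"
  have le: "a \<le> N" "Suc a \<le> N" "b \<le> N" "Suc b \<le> N" "a + b \<le> N" by (simp_all add: N_def)
  have p: "prime p" using prime_pr[where 'p='p] by (simp only: p_def)
  have p0: "p ^ (a + b) \<noteq> 0" using pr_gt_1[where 'p='p] by (simp add: p_def)
  have x0: "residue x a = 0" "residue x (Suc a) \<noteq> 0"
    using residue_eq_0_iff[OF assms(1), of a] residue_eq_0_iff[OF assms(1), of "Suc a"] by (simp_all add: a_def)
  have y0: "residue y b = 0" "residue y (Suc b) \<noteq> 0"
    using residue_eq_0_iff[OF assms(2), of b] residue_eq_0_iff[OF assms(2), of "Suc b"] by (simp_all add: b_def)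
  obtain u where u: "residue x N = p ^ a * u"
    using x0(1) residue_eq_0_iff_dvd[OF le(1), of x] unfolding p_def by blast
  obtain v where v: "residue y N = p ^ b * v"
    using y0(1) residue_eq_0_iff_dvd[OF le(3), of y] unfolding p_def by blast
  have "\<not> p dvd u"
  proof
    assume "p dvd u"
    then have "p ^ Suc a dvd residue x N" unfolding u power_Suc2 by (rule mult_dvd_mono[OF dvd_refl])
    then show False using x0(2) residue_eq_0_iff_dvd[OF le(2), of x] unfolding p_def by blast
  qed
  moreover have "\<not> p dvd v"
  proof
    assume "p dvd v"
    then have "p ^ Suc b dvd residue y N" unfolding v power_Suc2 by (rule mult_dvd_mono[OF dvd_refl])
    then show False using y0(2) residue_eq_0_iff_dvd[OF le(4), of y] unfolding p_def by blast
  qed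
  ultimately have uv: "\<not> p dvd u * v" using p by (simp add: prime_dvd_mult_iff)
  have "p ^ a * u * (p ^ b * v) = p ^ (a + b) * (u * v)" by (simp add: power_add)
  then have prod: "residue (x * y) N = (p ^ (a + b) * (u * v)) mod p ^ N"
    unfolding residue_mult u v p_def by (rule arg_cong)
  have "p ^ (a + b) dvd residue (x * y) N"
    unfolding prod by (rule dvd_mod[OF dvd_triv_left]) (rule le_imp_power_dvd[OF le(5)])
  then show "residue (x * y) (val_int x + val_int y) = 0"
    using residue_eq_0_iff_dvd[OF le(5), of "x * y"] unfolding p_def a_def b_def by blast
  show "residue (x * y) (Suc (val_int x + val_int y)) \<noteq> 0"
  proof
    assume "residue (x * y) (Suc (val_int x + val_int y)) = 0"
    then have "residue (x * y) N = 0" by (simp only: N_def a_def b_def)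
    then have "p ^ N dvd p ^ (a + b) * (u * v)"
      unfolding prod by (rule mod_0_imp_dvd)
    then have "p ^ (a + b) * p dvd p ^ (a + b) * (u * v)"
      unfolding N_def power_Suc2 .
    then have "p dvd u * v" using p0 by (subst (asm) dvd_mult_cancel_left) blast
    with uv show False ..
  qed
qed

instance padic_int :: (prime_card) idom
proof
  fix x y :: "'a padic_int"
  assume "x \<noteq> 0" "y \<noteq> 0"
  then show "x * y \<noteq> 0" using val_int_mult_aux(2)[of x y] by auto
qed

instance padic_int :: (prime_card) ring_char_0
proof
  show "inj (of_nat :: nat \<Rightarrow> 'a padic_int)"
  proof (rule injI)
    fix m n assume eq: "(of_nat m :: 'a padic_int) = of_nat n"
    define k where "k = max m n"
    have "k < CARD('a) ^ k"
      using pr_gt_1[where 'p='a] by (intro power_gt_expt) auto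
    then have "int k < pr TYPE('a) ^ k"
      by (simp only: of_nat_less_iff flip: of_nat_power)
    then have *: "int i mod pr TYPE('a) ^ k = int i" if "i \<le> k" for i
      using that by (intro mod_pos_pos_trivial) linarith+
    have "int m mod pr TYPE('a) ^ k = int n mod pr TYPE('a) ^ k"
      using arg_cong[OF eq, of "\<lambda>x. residue x k"] by (simp only: residue_of_nat)
    then show "m = n" using *[of m] *[of n] by (simp add: k_def)
  qed
qed

lemma val_int_mult:
  "x \<noteq> 0 \<Longrightarrow> y \<noteq> 0 \<Longrightarrow> val_int (x * y) = val_int x + val_int y"
  by (rule val_int_eqI) (fact val_int_mult_aux)+

lemma val_int_uminus: "val_int (- x) = val_int x"
proof (cases "x = 0")
  case False
  have "val_int (1 :: 'a padic_int) = val_int (1 :: 'a padic_int) + val_int (1 :: 'a padic_int)"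
    using val_int_mult[of "1 :: 'a padic_int" 1] by simp
  moreover have "val_int (1 :: 'a padic_int) = 2 * val_int (- 1 :: 'a padic_int)"
    using val_int_mult[of "-1 :: 'a padic_int" "-1"] by simp
  ultimately have "val_int (- 1 :: 'a padic_int) = 0" by simp
  then show ?thesis using val_int_mult[of "-1" x] False by simp
qed simp

lemma val_int_add:
  assumes "x \<noteq> 0" "y \<noteq> 0" "x + y \<noteq> 0"
  shows "val_int (x + y) \<ge> min (val_int x) (val_int y)"
proof -
  have "residue (x + y) (min (val_int x) (val_int y)) = 0"
    using residue_eq_0_iff[OF assms(1), of "min (val_int x) (val_int y)"]
      residue_eq_0_iff[OF assms(2), of "min (val_int x) (val_int y)"]
    by (simp add: residue_add)
  then show ?thesis using assms(3) by (simp add: residue_eq_0_iff)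
qed

instance fract :: ("{idom, ring_char_0}") field_char_0
proof
  show "inj (of_nat :: nat \<Rightarrow> 'a fract)"
    by (rule injI) (simp add: of_nat_fract eq_fract)
qed

type_synonym 'p padic = "'p padic_int fract"

text \<open>
  The valuation of a quotient \<open>a / b\<close> is \<open>v\<^sub>p(a) - v\<^sub>p(b)\<close>. Mathematically \<open>v\<^sub>p(0) = \<infinity>\<close>; here the
  value at \<open>0\<close> is an arbitrary integer, and zero is always treated separately.
\<close>

definition padic_val :: "'p::prime_card padic \<Rightarrow> int" where
  "padic_val x = (THE n. \<exists>a b. b \<noteq> 0 \<and> x = Fract a b \<and> n = int (val_int a) - int (val_int b))"

definition padic_norm :: "'p::prime_card padic \<Rightarrow> real" where
  "padic_norm x = (if x = 0 then 0 else real CARD('p) powi (- padic_val x))"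

lemma padic_val_Fract:
  fixes a b :: "'p::prime_card padic_int"
  assumes "a \<noteq> 0" "b \<noteq> 0"
  shows "padic_val (Fract a b) = int (val_int a) - int (val_int b)"
  unfolding padic_val_def
proof (rule the_equality)
  fix n assume "\<exists>c d. d \<noteq> 0 \<and> Fract a b = Fract c d \<and> n = int (val_int c) - int (val_int d)"
  then obtain c d where d: "d \<noteq> 0" and eq: "Fract a b = Fract c d"
    and n: "n = int (val_int c) - int (val_int d)"
    by auto
  have ad: "a * d = c * b" using eq assms d by (simp add: eq_fract)
  then have "c \<noteq> 0" using assms d by auto
  then have "val_int a + val_int d = val_int c + val_int b"
    using ad assms d by (metis val_int_mult)
  then show "n = int (val_int a) - int (val_int b)" using n by linarith
qed (use assms in blast)

lemma padic_norm_zero [simp]: "padic_norm 0 = 0"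
  by (simp add: padic_norm_def)

lemma padic_norm_pos: "x \<noteq> 0 \<Longrightarrow> padic_norm (x :: 'p::prime_card padic) > 0"
  using pr_gt_1[where 'p='p] by (simp add: padic_norm_def zero_less_power_int)

lemma padic_norm_nonneg: "padic_norm x \<ge> 0"
  using padic_norm_pos[of x] by (cases "x = 0") auto

lemma padic_nonzero_cases:
  assumes "(x :: 'p::prime_card padic) \<noteq> 0"
  obtains a b where "a \<noteq> 0" "b \<noteq> 0" "x = Fract a b"
  using assms by (cases x rule: Fract_cases_nonzero) auto

lemma padic_val_mult:
  fixes x y :: "'p::prime_card padic"
  assumes "x \<noteq> 0" "y \<noteq> 0"
  shows "padic_val (x * y) = padic_val x + padic_val y"
proof -
  obtain a b where x: "a \<noteq> 0" "b \<noteq> 0" "x = Fract a b" using assms(1) by (rule padic_nonzero_cases)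
  obtain c d where y: "c \<noteq> 0" "d \<noteq> 0" "y = Fract c d" using assms(2) by (rule padic_nonzero_cases)
  show ?thesis using x y by (simp add: padic_val_Fract val_int_mult)
qed

lemma padic_norm_mult: "padic_norm (x * y) = padic_norm x * padic_norm y"
  for x y :: "'p::prime_card padic"
  using pr_gt_1[where 'p='p]
  by (auto simp: padic_norm_def padic_val_mult power_int_add[symmetric])

lemma padic_val_uminus: "padic_val (- x) = padic_val x"
proof (cases "x = 0")
  case False
  then obtain a b where "a \<noteq> 0" "b \<noteq> 0" "x = Fract a b" by (rule padic_nonzero_cases)
  then show ?thesis by (simp add: padic_val_Fract val_int_uminus)
qed simp

lemma padic_norm_uminus [simp]: "padic_norm (- x) = padic_norm x"
  by (simp add: padic_norm_def padic_val_uminus)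

lemma padic_norm_diff_commute: "padic_norm (x - y) = padic_norm (y - x)"
  using padic_norm_uminus[of "x - y"] by simp

lemma padic_val_add:
  fixes x y :: "'p::prime_card padic"
  assumes "x \<noteq> 0" "y \<noteq> 0" "x + y \<noteq> 0"
  shows "padic_val (x + y) \<ge> min (padic_val x) (padic_val y)"
proof -
  obtain a b where x: "a \<noteq> 0" "b \<noteq> 0" "x = Fract a b" using assms(1) by (rule padic_nonzero_cases)
  obtain c d where y: "c \<noteq> 0" "d \<noteq> 0" "y = Fract c d" using assms(2) by (rule padic_nonzero_cases)
  have xy: "x + y = Fract (a * d + c * b) (b * d)" using x y by simp
  then have "a * d + c * b \<noteq> 0" using assms(3) x y by (auto simp: fract_collapse)
  then show ?thesis
    using val_int_add[of "a * d" "c * b"] x y xy by (simp add: padic_val_Fract val_int_mult)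
qed

lemma padic_norm_add: "padic_norm (x + y) \<le> max (padic_norm x) (padic_norm y)"
  for x y :: "'p::prime_card padic"
proof (cases "x = 0 \<or> y = 0 \<or> x + y = 0")
  case True
  then show ?thesis using padic_norm_nonneg[of x] padic_norm_nonneg[of y] by (auto simp: max_def)
next
  case False
  have mono: "real CARD('p) powi (- n) \<le> real CARD('p) powi (- m)" if "m \<le> n" for m n
    using that pr_gt_1[where 'p='p] by (intro power_int_increasing) auto
  show ?thesis using False padic_val_add[of x y] mono
    by (auto simp: padic_norm_def le_max_iff_disj min_le_iff_disj)
qed

lemma val_int_of_int:
  assumes "m \<noteq> 0"
  shows "val_int (of_int m :: 'p::prime_card padic_int) = multiplicity (pr TYPE('p)) m"
proof (rule val_int_eqI)
  have "\<not> is_unit (pr TYPE('p))" using pr_gt_1[where 'p='p] by (simp add: zdvd1_eq)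
  then show "residue (of_int m :: 'p padic_int) (Suc (multiplicity (pr TYPE('p)) m)) \<noteq> 0"
    using assms power_dvd_iff_le_multiplicity[where p = "pr TYPE('p)" and x = m
        and n = "Suc (multiplicity (pr TYPE('p)) m)"]
    unfolding residue_of_int by (auto simp: mod_eq_0_iff_dvd simp del: power_Suc)
  show "residue (of_int m :: 'p padic_int) (multiplicity (pr TYPE('p)) m) = 0"
    unfolding residue_of_int by (simp add: multiplicity_dvd)
qed

text \<open>The norm extends the usual \<open>p\<close>-adic absolute value on the integers.\<close>

lemma padic_norm_of_int:
  assumes "m \<noteq> 0"
  shows "padic_norm (of_int m :: 'p::prime_card padic)
    = real CARD('p) powi (- int (multiplicity (pr TYPE('p)) m))"
proof -
  have 0: "(of_int m :: 'p padic_int) \<noteq> 0" using assms by simp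
  have "(of_int m :: 'p padic) = Fract (of_int m) 1"
    by (cases m rule: int_cases2) (simp_all add: of_nat_fract)
  moreover have "val_int (1 :: 'p padic_int) = 0"
    using val_int_of_int[of 1, where 'p='p] by simp
  ultimately have "padic_val (of_int m :: 'p padic) = int (multiplicity (pr TYPE('p)) m)"
    using 0 by (simp add: padic_val_Fract val_int_of_int assms)
  then show ?thesis using assms by (simp add: padic_norm_def)
qed

lemma padic_norm_of_nat_card: "padic_norm (of_nat CARD('p) :: 'p::prime_card padic) = 1 / real CARD('p)"
proof -
  have "multiplicity (pr TYPE('p)) (pr TYPE('p)) = 1"
    using pr_gt_1[where 'p='p] by (intro multiplicity_self) (auto simp: zdvd1_eq)
  then show ?thesis
    using padic_norm_of_int[of "pr TYPE('p)", where 'p='p] pr_gt_1[where 'p='p]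
    by (simp add: power_int_minus field_simps)
qed

lemma padic_norm_1: "padic_norm (1 :: 'p::prime_card padic) = 1"
  using padic_norm_of_int[of 1, where 'p='p] by simp

lemma padic_norm_power: "padic_norm (x ^ n) = padic_norm x ^ n"
  for x :: "'p::prime_card padic"
  by (induction n) (simp_all add: padic_norm_mult padic_norm_1)

lemma padic_norm_card_powi:
  "padic_norm (of_nat CARD('p) powi n :: 'p::prime_card padic) = real CARD('p) powi (- n)"
proof -
  have P: "padic_norm (of_nat CARD('p) ^ k :: 'p padic) = 1 / real CARD('p) ^ k" for k
    by (simp add: padic_norm_power padic_norm_of_nat_card power_one_over)
  show ?thesis
  proof (cases "n \<ge> 0")
    case True
    then obtain k where "n = int k" using nonneg_int_cases by blast
    then show ?thesis using P[of k] by (simp add: power_int_minus field_simps)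
  next
    case False
    then obtain k where n: "n = - int k" by (metis int_cases2 neg_0_le_iff_le of_nat_0_le_iff)
    let ?x = "of_nat CARD('p) ^ k :: 'p padic"
    have "?x \<noteq> 0" by simp
    then have "padic_norm ?x * padic_norm (inverse ?x) = 1"
      by (metis padic_norm_mult right_inverse padic_norm_1)
    then have "padic_norm (inverse ?x) = real CARD('p) ^ k"
      unfolding P by (simp add: field_simps)
    then show ?thesis by (simp add: n power_int_minus)
  qed
qed

lemma padic_norm_sum_le:
  assumes "finite I" "\<And>i. i \<in> I \<Longrightarrow> padic_norm (f i :: 'p::prime_card padic) \<le> c" "c \<ge> 0"
  shows "padic_norm (\<Sum>i\<in>I. f i) \<le> c"
  using assms
proof (induction I rule: finite_induct)
  case (insert i I)
  then show ?case using padic_norm_add[of "f i" "sum f I"] by fastforce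
qed simp

lemma padic_norm_of_int_le: "padic_norm (of_int m :: 'p::prime_card padic) \<le> 1"
  using pr_gt_1[where 'p='p]
  by (cases "m = 0") (auto simp: padic_norm_of_int power_int_minus divide_simps one_le_power)

lemma padic_norm_of_int_eq_1:
  "\<not> pr TYPE('p) dvd m \<Longrightarrow> padic_norm (of_int m :: 'p::prime_card padic) = 1"
  by (cases "m = 0") (auto simp: padic_norm_of_int not_dvd_imp_multiplicity_0)

section \<open>Balanced expansions and the functions \<open>s\<close> and \<open>t\<close>\<close>

text \<open>\<open>a\<close> is the digit sequence of \<open>x\<close>, with digits in \<open>{-(p-1)/2..(p-1)/2}\<close> for \<open>p\<close> odd.\<close>

definition balanced_expansion :: "(int \<Rightarrow> int) \<Rightarrow> 'p::prime_card padic \<Rightarrow> bool" where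
  "balanced_expansion a x \<longleftrightarrow>
     (\<forall>n. 2 * \<bar>a n\<bar> \<le> pr TYPE('p) - 1) \<and>
     (\<exists>r. (\<forall>n < r. a n = 0) \<and>
          (\<lambda>N. padic_norm (x - (\<Sum>n = r..int N. of_int (a n) * of_nat CARD('p) powi n)))
            \<longlonglongrightarrow> 0)"

definition padic_digits :: "'p::prime_card padic \<Rightarrow> int \<Rightarrow> int" where
  "padic_digits x = (THE a. balanced_expansion a x)"

lemma balanced_expansion_unique:
  fixes x :: "'p::prime_card padic"
  assumes "balanced_expansion a x" "balanced_expansion a' x"
  shows "a = a'"
proof (rule ccontr)
  let ?P = "of_nat CARD('p) :: 'p padic"
  define S where "S = (\<lambda>(a :: int \<Rightarrow> int) r N. \<Sum>n = r..int N. of_int (a n) * ?P powi n)"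
  obtain r where r: "\<forall>n<r. a n = 0" "(\<lambda>N. padic_norm (x - S a r N)) \<longlonglongrightarrow> 0"
    using assms(1) unfolding balanced_expansion_def S_def by blast
  obtain r' where r': "\<forall>n<r'. a' n = 0" "(\<lambda>N. padic_norm (x - S a' r' N)) \<longlonglongrightarrow> 0"
    using assms(2) unfolding balanced_expansion_def S_def by blast
  assume "a \<noteq> a'"
  then obtain j0 where j0: "a j0 \<noteq> a' j0" by auto
  define r0 where "r0 = min r r'"
  have zero: "a n = 0" "a' n = 0" if "n < r0" for n using that r(1) r'(1) by (auto simp: r0_def)
  have "\<exists>i. a (r0 + int i) \<noteq> a' (r0 + int i)"
    using j0 zero[of j0] by (intro exI[of _ "nat (j0 - r0)"]) (cases "j0 < r0", auto)
  then obtain i where i: "a (r0 + int i) \<noteq> a' (r0 + int i)"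
    "\<And>k. k < i \<Longrightarrow> a (r0 + int k) = a' (r0 + int k)"
    using exists_least_iff[of "\<lambda>i. a (r0 + int i) \<noteq> a' (r0 + int i)"] by blast
  define j where "j = r0 + int i"
  have j: "a j \<noteq> a' j" using i(1) by (simp add: j_def)
  have eq: "a n = a' n" if "n < j" for n
    using i(2)[of "nat (n - r0)"] zero[of n] that by (cases "n < r0") (auto simp: j_def)
  define e where "e = (\<lambda>n. a n - a' n)"
  have Sr: "S a r N = S a r0 N" "S a' r' N = S a' r0 N" for N
    unfolding S_def using r(1) r'(1) by (auto intro!: sum.mono_neutral_left simp: r0_def)
  have diff: "S a r N - S a' r' N = (\<Sum>n = j..int N. of_int (e n) * ?P powi n)" for N
  proof -
    have "S a r N - S a' r' N = (\<Sum>n = r0..int N. of_int (e n) * ?P powi n)"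
      unfolding Sr by (simp add: S_def e_def sum_subtractf algebra_simps)
    also have "\<dots> = (\<Sum>n = j..int N. of_int (e n) * ?P powi n)"
      using eq by (intro sum.mono_neutral_right) (auto simp: e_def j_def)
    finally show ?thesis .
  qed
  let ?q = "real CARD('p)"
  have q: "?q > 1" using pr_gt_1[where 'p='p] by simp
  have "\<bar>e j\<bar> < pr TYPE('p)"
  proof -
    have "2 * \<bar>a j\<bar> \<le> pr TYPE('p) - 1" "2 * \<bar>a' j\<bar> \<le> pr TYPE('p) - 1"
      using assms unfolding balanced_expansion_def by blast+
    then show ?thesis by (simp add: e_def)
  qed
  then have "\<not> pr TYPE('p) dvd e j"
    using j dvd_imp_le_int[of "e j" "pr TYPE('p)"] by (auto simp: e_def)
  then have ej: "padic_norm (of_int (e j) * ?P powi j) = ?q powi (- j)"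
    by (simp add: padic_norm_mult padic_norm_of_int_eq_1 padic_norm_card_powi)
  have low: "?q powi (- j) \<le> padic_norm (S a r N - S a' r' N)" if "int N \<ge> j" for N
  proof -
    let ?T = "\<Sum>n = j+1..int N. of_int (e n) * ?P powi n"
    have "{j..int N} = insert j {j+1..int N}" using that by auto
    then have split: "of_int (e j) * ?P powi j = (S a r N - S a' r' N) + (- ?T)"
      unfolding diff by simp
    have "padic_norm ?T \<le> ?q powi (- (j + 1))"
    proof (rule padic_norm_sum_le)
      fix n assume "n \<in> {j+1..int N}"
      then have "?q powi (- n) \<le> ?q powi (- (j + 1))" using q by (intro power_int_increasing) auto
      moreover have "padic_norm (of_int (e n) * ?P powi n) \<le> 1 * ?q powi (- n)"
        unfolding padic_norm_mult padic_norm_card_powi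
        by (intro mult_right_mono padic_norm_of_int_le) (simp add: zero_le_power_int)
      ultimately show "padic_norm (of_int (e n) * ?P powi n) \<le> ?q powi (- (j + 1))" by simp
    qed (auto simp: zero_le_power_int)
    moreover have "?q powi (- (j + 1)) < ?q powi (- j)"
      using q by (intro power_int_strict_increasing) auto
    ultimately have "padic_norm (- ?T) < ?q powi (- j)" by simp
    moreover have "?q powi (- j) \<le> max (padic_norm (S a r N - S a' r' N)) (padic_norm (- ?T))"
      using padic_norm_add[of "S a r N - S a' r' N" "- ?T"] unfolding split[symmetric] ej .
    ultimately show ?thesis by linarith
  qed
  have "(\<lambda>N. max (padic_norm (x - S a' r' N)) (padic_norm (x - S a r N))) \<longlonglongrightarrow> max 0 0"
    by (intro tendsto_max r r')
  then have "(\<lambda>N. max (padic_norm (x - S a' r' N)) (padic_norm (x - S a r N))) \<longlonglongrightarrow> 0" by simp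
  moreover have "?q powi (- j) > 0" using q by (intro zero_less_power_int) simp
  ultimately have "eventually (\<lambda>N. max (padic_norm (x - S a' r' N)) (padic_norm (x - S a r N)) < ?q powi (- j)) sequentially"
    by (rule order_tendstoD)
  moreover have "eventually (\<lambda>N. int N \<ge> j) sequentially"
    using eventually_ge_at_top[of "nat j"] by eventually_elim linarith
  ultimately have "eventually (\<lambda>_. False) sequentially"
  proof eventually_elim
    case (elim N)
    have "padic_norm (S a r N - S a' r' N)
        \<le> max (padic_norm (x - S a' r' N)) (padic_norm (- (x - S a r N)))"
      using padic_norm_add[of "x - S a' r' N" "- (x - S a r N)"] by simp
    then show False using low[OF elim(2)] elim(1) by (simp only: padic_norm_uminus)
  qed
  then show False by simp
qed

lemma padic_int_divide_power:
  fixes y :: "'p::prime_card padic_int"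
  assumes "residue y m = 0"
  shows "\<exists>z. y = of_nat CARD('p) ^ m * z"
proof -
  define p where "p = pr TYPE('p)"
  have p0: "p > 0" using pr_gt_1[where 'p='p] by (simp add: p_def)
  define f where "f = (\<lambda>n. residue y (n + m) div p ^ m)"
  have f: "f (Suc n) mod p ^ n = f n" for n
  proof -
    have "residue y (n + m) = residue y (Suc n + m) mod (p ^ m * p ^ n)"
      using residue_Suc_mod[of y "n + m"] by (simp add: p_def power_add mult.commute)
    also have "\<dots> = p ^ m * (f (Suc n) mod p ^ n) + residue y (Suc n + m) mod p ^ m"
      using p0 unfolding f_def by (intro zmod_zmult2_eq) simp
    also have "residue y (Suc n + m) mod p ^ m = 0"
      using residue_mod[of m "Suc n + m" y] assms by (simp add: p_def)
    finally show ?thesis unfolding f_def using p0 by simp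
  qed
  then have res: "residue (Abs_padic_int f :: 'p padic_int) = f"
    by (intro Abs_padic_int_inverse) (simp add: p_def)
  have "y = of_nat CARD('p) ^ m * Abs_padic_int f"
  proof (rule residue_eqI)
    fix n
    have dvd: "p ^ m dvd residue y (n + m)"
      using assms residue_eq_0_iff_dvd[of m "n + m" y] by (simp add: p_def)
    have "residue (of_nat CARD('p) ^ m :: 'p padic_int) n = p ^ m mod p ^ n"
      using residue_of_nat[of "CARD('p) ^ m" n, where 'p='p] by (simp add: p_def)
    then have "residue (of_nat CARD('p) ^ m * Abs_padic_int f :: 'p padic_int) n
        = (p ^ m * f n) mod p ^ n"
      unfolding residue_mult res p_def by (simp add: mod_mult_left_eq)
    also have "p ^ m * f n = residue y (n + m)" using dvd by (simp add: f_def)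
    also have "residue y (n + m) mod p ^ n = residue y n"
      unfolding p_def by (rule residue_mod) simp
    finally show "residue y n = residue (of_nat CARD('p) ^ m * Abs_padic_int f :: 'p padic_int) n"
      by (rule sym)
  qed
  then show ?thesis ..
qed

lemma balanced_digit_exists:
  fixes a b :: "'p::prime_card padic_int"
  assumes "odd CARD('p)" "residue b 1 \<noteq> 0"
  shows "\<exists>d a'. 2 * \<bar>d\<bar> \<le> pr TYPE('p) - 1 \<and> a = of_int d * b + of_nat CARD('p) * a'"
proof -
  define p where "p = pr TYPE('p)"
  have p: "prime p" "odd p" "p > 1"
    using prime_pr[where 'p='p] assms(1) pr_gt_1[where 'p='p] by (simp_all add: p_def)
  have "residue b 1 mod p = residue b 1" using residue_mod[of 1 1 b] by (simp add: p_def)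
  then have "\<not> p dvd residue b 1" using assms(2) by (simp add: dvd_eq_mod_eq_0)
  then have "coprime (residue b 1) p" using p(1) prime_imp_coprime[of p "residue b 1"]
    by (simp add: coprime_commute)
  then obtain u v where uv: "u * residue b 1 + v * p = 1"
    using bezout_int[of "residue b 1" p] by auto
  define c where "c = residue a 1 * u"
  define h where "h = (p - 1) div 2"
  have h: "2 * h = p - 1" using p(2) by (auto simp: h_def)
  define d where "d = (c + h) mod p - h"
  have d: "0 \<le> d + h" "d + h < p" using p(3) by (simp_all add: d_def)
  then have d_le: "2 * \<bar>d\<bar> \<le> p - 1" using h by linarith
  have "p dvd d - c"
  proof -
    have "p dvd (c + h) - (c + h) mod p" by (rule dvd_minus_mod)
    also have "(c + h) - (c + h) mod p = c - d" by (simp add: d_def)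
    finally have "p dvd c - d" .
    then show ?thesis by (simp add: dvd_diff_commute)
  qed
  then obtain l where l: "d - c = p * l" by (rule dvdE)
  then have l: "d = c + p * l" by simp
  have "residue a 1 - d * residue b 1 = residue a 1 * (1 - u * residue b 1) - p * (l * residue b 1)"
    unfolding l c_def by (simp add: algebra_simps)
  also have "1 - u * residue b 1 = p * v" using uv by (simp add: algebra_simps)
  finally have "residue a 1 - d * residue b 1 = p * (residue a 1 * v - l * residue b 1)"
    by (simp add: algebra_simps)
  then have "p dvd residue a 1 - d * residue b 1" by simp
  moreover have "residue (a - of_int d * b) 1 = (residue a 1 - d * residue b 1) mod p"
    by (simp add: residue_diff residue_mult residue_of_int p_def mod_mult_left_eq mod_diff_right_eq)
  ultimately have "residue (a - of_int d * b) 1 = 0" by simp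
  then obtain a' where "a - of_int d * b = of_nat CARD('p) * a'"
    using padic_int_divide_power[of "a - of_int d * b" 1] by auto
  then have "a = of_int d * b + of_nat CARD('p) * a'" by (simp add: algebra_simps)
  with d_le show ?thesis unfolding p_def by blast
qed

lemma balanced_expansion_exists:
  fixes x :: "'p::prime_card padic"
  assumes "odd CARD('p)"
  shows "\<exists>a. balanced_expansion a x"
proof -
  let ?P = "of_nat CARD('p) :: 'p padic" and ?q = "real CARD('p)"
  have q: "?q > 1" using pr_gt_1[where 'p='p] by simp
  obtain a0 b0 where x: "x = Fract a0 b0" "b0 \<noteq> 0" by (cases x) auto
  define m where "m = val_int b0"
  obtain b where b0: "b0 = of_nat CARD('p) ^ m * b"
    using padic_int_divide_power[of b0 m] residue_eq_0_iff[OF x(2), of m] by (auto simp: m_def)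
  have b: "b \<noteq> 0" using x(2) b0 by auto
  have "val_int b = 0"
  proof -
    have "\<not> is_unit (pr TYPE('p))" using pr_gt_1[where 'p='p] by (simp add: zdvd1_eq)
    then have "multiplicity (pr TYPE('p)) (pr TYPE('p) ^ m) = m"
      by (intro multiplicity_same_power) auto
    moreover have "val_int (of_int (pr TYPE('p) ^ m) :: 'p padic_int)
        = multiplicity (pr TYPE('p)) (pr TYPE('p) ^ m)"
      by (rule val_int_of_int) simp
    moreover have "of_int (pr TYPE('p) ^ m) = (of_nat CARD('p) ^ m :: 'p padic_int)" by simp
    ultimately have "val_int (of_nat CARD('p) ^ m :: 'p padic_int) = m" by (simp only:)
    moreover have "val_int b0 = val_int (of_nat CARD('p) ^ m :: 'p padic_int) + val_int b"
      unfolding b0 by (rule val_int_mult) (use b in auto)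
    ultimately show ?thesis using m_def by linarith
  qed
  then have "residue b 1 \<noteq> 0" using residue_eq_0_iff[OF b, of 1] by simp
  then obtain D A where D: "\<And>a. 2 * \<bar>D a\<bar> \<le> pr TYPE('p) - 1"
    and A: "\<And>a. a = of_int (D a) * b + of_nat CARD('p) * A a"
    using balanced_digit_exists[OF assms] by metis
  define u where "u = (\<lambda>n. (A ^^ n) a0)"
  define F where "F = (\<lambda>a. Fract a b)"
  have F: "F a = of_int (D a) + ?P * F (A a)" for a
  proof -
    have "F a = Fract (of_int (D a)) 1 + Fract (of_nat CARD('p)) 1 * Fract (A a) b"
      unfolding F_def using b by (subst A[of a]) (simp add: eq_fract algebra_simps)
    moreover have "Fract (of_int (D a)) 1 = (of_int (D a) :: 'p padic)"
      by (cases "D a" rule: int_cases2) (simp_all add: of_nat_fract)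
    ultimately show ?thesis by (simp add: F_def of_nat_fract)
  qed
  have F_le: "padic_norm (F a) \<le> 1" for a
  proof (cases "a = 0")
    case True
    then show ?thesis by (simp add: F_def fract_collapse)
  next
    case False
    then show ?thesis using b \<open>val_int b = 0\<close> q
      by (simp add: F_def padic_norm_def padic_val_Fract power_int_minus divide_simps one_le_power)
  qed
  have P0: "?P \<noteq> 0" by simp
  define g where "g = (\<lambda>j. if j < - int m then 0 else D (u (nat (j + int m))))"
  have partial: "F a0 * ?P powi (- int m)
      = (\<Sum>j = - int m..<- int m + int n. of_int (g j) * ?P powi j) + ?P powi (int n - int m) * F (u n)" for n
  proof (induction n)
    case 0
    show ?case by (simp add: u_def)
  next
    case (Suc n)
    have "{- int m..<- int m + int (Suc n)} = insert (int n - int m) {- int m..<- int m + int n}" by auto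
    then have "(\<Sum>j = - int m..<- int m + int (Suc n). of_int (g j) * ?P powi j)
       = of_int (D (u n)) * ?P powi (int n - int m)
         + (\<Sum>j = - int m..<- int m + int n. of_int (g j) * ?P powi j)"
      by (simp add: g_def)
    moreover have "?P powi (int n - int m) * F (u n)
        = of_int (D (u n)) * ?P powi (int n - int m) + ?P powi (int (Suc n) - int m) * F (u (Suc n))"
    proof -
      have "?P powi (int (Suc n) - int m) = ?P powi (int n - int m) * ?P"
        using power_int_add_1[of ?P "int n - int m"] P0 by (simp add: algebra_simps)
      moreover have "u (Suc n) = A (u n)" by (simp add: u_def)
      ultimately show ?thesis by (subst F[of "u n"]) (simp add: algebra_simps)
    qed
    ultimately show ?case using Suc.IH by simp
  qed
  have xF: "x = F a0 * ?P powi (- int m)"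
  proof -
    have "?P ^ m = Fract (of_nat CARD('p) ^ m) 1"
      using of_nat_fract[of "CARD('p) ^ m", where 'a="'p padic_int"] by simp
    then show ?thesis using b
      by (simp add: x(1) b0 F_def power_int_minus mult.commute)
  qed
  have est: "padic_norm (x - (\<Sum>n = - int m..int N. of_int (g n) * ?P powi n)) \<le> inverse (?q ^ N)" for N
  proof -
    have "{- int m..int N} = {- int m..<- int m + int (N + m + 1)}" by auto
    then have "x - (\<Sum>n = - int m..int N. of_int (g n) * ?P powi n) = ?P powi (int N + 1) * F (u (N + m + 1))"
      using partial[of "N + m + 1"] xF by (simp add: algebra_simps)
    moreover have "padic_norm (?P powi (int N + 1) * F (u (N + m + 1))) \<le> ?q powi (- (int N + 1)) * 1"
      unfolding padic_norm_mult padic_norm_card_powi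
      by (intro mult_left_mono F_le) (simp add: zero_le_power_int)
    ultimately have "padic_norm (x - (\<Sum>n = - int m..int N. of_int (g n) * ?P powi n))
        \<le> ?q powi (- (int N + 1)) * 1"
      by (simp only:)
    also have "\<dots> \<le> ?q powi (- int N)" using q by (simp add: power_int_increasing)
    finally show ?thesis by (simp add: power_int_minus)
  qed
  have "(\<lambda>N. inverse (?q ^ N)) \<longlonglongrightarrow> 0" by (rule LIMSEQ_inverse_realpow_zero[OF q])
  then have "(\<lambda>N. padic_norm (x - (\<Sum>n = - int m..int N. of_int (g n) * ?P powi n))) \<longlonglongrightarrow> 0"
    by (rule real_tendsto_sandwich[OF always_eventually always_eventually tendsto_const, rotated 2])
      (simp_all only: padic_norm_nonneg est simp_thms)
  moreover have "2 * \<bar>g n\<bar> \<le> pr TYPE('p) - 1" for n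
    using D pr_gt_1[where 'p='p] by (simp add: g_def)
  ultimately have "balanced_expansion g x"
    unfolding balanced_expansion_def by (intro conjI allI exI[of _ "- int m"]) (auto simp: g_def)
  then show ?thesis by blast
qed

text \<open>Hence the digits of \<open>x\<close> are well defined.\<close>

lemma balanced_expansion_padic_digits:
  fixes x :: "'p::prime_card padic"
  assumes "odd CARD('p)"
  shows "balanced_expansion (padic_digits x) x"
  unfolding padic_digits_def
  using balanced_expansion_exists[OF assms, of x] balanced_expansion_unique[of _ x]
  by (metis the_equality)

definition browkin_s :: "'p::prime_card padic \<Rightarrow> rat" where
  "browkin_s x = (\<Sum>n | n \<le> 0 \<and> padic_digits x n \<noteq> 0.
     of_int (padic_digits x n) * of_nat CARD('p) powi n)"

definition browkin_t :: "'p::prime_card padic \<Rightarrow> rat" where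
  "browkin_t x = (\<Sum>n | n < 0 \<and> padic_digits x n \<noteq> 0.
     of_int (padic_digits x n) * of_nat CARD('p) powi n)"

section \<open>The algorithm Browkin II\<close>

text \<open>The condition \<open>v\<^sub>p(x - t(x)) = 0\<close> fails for \<open>x = t(x)\<close>, as \<open>v\<^sub>p(0) = \<infinity>\<close>.\<close>

definition browkin2_step :: "nat \<Rightarrow> 'p::prime_card padic \<Rightarrow> rat" where
  "browkin2_step n x =
     (if even n then browkin_s x
      else if x \<noteq> of_rat (browkin_t x) \<and> padic_val (x - of_rat (browkin_t x)) = 0
      then browkin_t x
      else browkin_t x - sgn (browkin_t x))"

text \<open>
  The complete quotients \<open>\<alpha>\<^sub>n\<close>. The algorithm stops at the first \<open>n\<close> with \<open>\<alpha>\<^sub>n = b\<^sub>n\<close>; the values at later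
  indices are junk, so that infinite expansions are singled out separately.
\<close>

primrec browkin2_quot :: "'p::prime_card padic \<Rightarrow> nat \<Rightarrow> 'p padic" where
  "browkin2_quot \<alpha> 0 = \<alpha>"
| "browkin2_quot \<alpha> (Suc n) =
     1 / (browkin2_quot \<alpha> n - of_rat (browkin2_step n (browkin2_quot \<alpha> n)))"

definition browkin2_coeff :: "'p::prime_card padic \<Rightarrow> nat \<Rightarrow> rat" where
  "browkin2_coeff \<alpha> n = browkin2_step n (browkin2_quot \<alpha> n)"

definition browkin2_infinite :: "'p::prime_card padic \<Rightarrow> bool" where
  "browkin2_infinite \<alpha> \<longleftrightarrow> (\<forall>n. browkin2_quot \<alpha> n \<noteq> of_rat (browkin2_coeff \<alpha> n))"

definition browkin2_purely_periodic :: "'p::prime_card padic \<Rightarrow> nat \<Rightarrow> bool" where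
  "browkin2_purely_periodic \<alpha> k \<longleftrightarrow>
     k \<ge> 1 \<and> browkin2_infinite \<alpha> \<and> (\<forall>n. browkin2_coeff \<alpha> (n + k) = browkin2_coeff \<alpha> n)"

section \<open>Conjugates\<close>

text \<open>Irreducible polynomials over \<open>\<rat>\<close> are separable, so the other root differs from \<open>\<alpha>\<close>.\<close>

definition quadratic_conjugate :: "'a::field_char_0 \<Rightarrow> 'a \<Rightarrow> bool" where
  "quadratic_conjugate \<alpha> \<beta> \<longleftrightarrow>
     (\<exists>f :: rat poly. irreducible f \<and> degree f = 2 \<and>
        poly (map_poly of_rat f) \<alpha> = 0 \<and> poly (map_poly of_rat f) \<beta> = 0 \<and> \<beta> \<noteq> \<alpha>)"

end

theory Submission
  imports Defs
begin

text \<open>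
  Write \<open>\<alpha>\<^sub>n\<close> for the complete quotients, \<open>b\<^sub>n\<close> for the partial quotients and \<open>|.|\<close> for the \<open>p\<close>-adic norm.
  At an even step \<open>s\<close> leaves a remainder of norm at most \<open>1/p\<close>, and at an odd step \<open>t\<close>, corrected by a
  sign if need be, leaves a remainder of norm exactly \<open>1\<close>. Hence \<open>|\<alpha>\<^sub>n| \<ge> p\<close> for odd \<open>n\<close>, \<open>|\<alpha>\<^sub>n| = 1\<close> for
  even \<open>n > 0\<close>, and \<open>|b\<^sub>n| = |\<alpha>\<^sub>n|\<close> for all \<open>n > 0\<close> (\<open>padic_norm_odd_quot\<close>, \<open>padic_norm_even_quot\<close>,
  \<open>padic_norm_coeff_eq_quot\<close>).

  Let the expansion be purely periodic. Doubling the period makes it even, so that the shift by one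
  period preserves the two kinds of steps. Two complete quotients with the same
  partial quotients coincide, because each pair of steps multiplies their distance by at least
  \<open>p\<close>, while that distance never exceeds \<open>1\<close> at even indices. So \<open>\<alpha>\<close> recurs among the \<open>\<alpha>\<^sub>n\<close> with \<open>n > 0\<close> even
  (\<open>browkin2_quot_periodic\<close>), which gives \<open>|\<alpha>| = 1\<close>. Moreover \<open>\<alpha>\<close> is a fixed point of a map
  \<open>z \<mapsto> (a z + b) / (c z + d)\<close> built from the \<open>b\<^sub>n\<close>. Its coefficients are continuants, and as every product
  \<open>b\<^sub>n b\<^sub>n\<^sub>+\<^sub>1\<close> has norm greater than \<open>1\<close>, the norm of a continuant is that of its leading product. This yields
  \<open>|b| < |a| = |c|\<close> (\<open>browkin2_quot_moebius\<close>). Thus \<open>\<alpha>\<close> is a root of \<open>c X\<^sup>2 + (d - a) X - b\<close>, the product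
  \<open>- b / c\<close> of the two roots has norm less than \<open>1\<close>, and since \<open>|\<alpha>| = 1\<close> the other root is the small one.

  For this root to be the conjugate of \<open>\<alpha>\<close>, the number \<open>\<alpha>\<close> must be irrational, and only here does the
  size of the \<open>b\<^sub>n\<close> as real numbers matter: it is at most \<open>(p - 1) / 2\<close> for even \<open>n > 0\<close> and less than \<open>1\<close>
  for odd \<open>n\<close>. If \<open>\<alpha>\<^sub>n = u / w\<close> with integers \<open>u, w\<close> and \<open>n > 0\<close> even, then \<open>\<alpha>\<^sub>n\<^sub>+\<^sub>2\<close> is a quotient of
  strictly smaller integers (\<open>rational_even_quot_descent\<close>), so that no rational number has an infinite expansion.
\<close>

section \<open>The ultrametric norm\<close>

lemma padic_norm_add_eq_right:
  fixes x y :: "'p::prime_card padic"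
  assumes "padic_norm x < padic_norm y"
  shows "padic_norm (x + y) = padic_norm y"
  using padic_norm_add[of x y] padic_norm_add[of "x + y" "- x"] assms by auto

lemma padic_norm_eq_if_diff_less:
  fixes x y :: "'p::prime_card padic"
  assumes "padic_norm (x - y) < padic_norm x \<or> padic_norm (x - y) < padic_norm y"
  shows "padic_norm x = padic_norm y"
  using assms padic_norm_add_eq_right[of "y - x" x] padic_norm_add_eq_right[of "x - y" y]
  by (auto simp: padic_norm_diff_commute)

lemma padic_norm_inverse: "padic_norm (1 / x) = 1 / padic_norm x"
  for x :: "'p::prime_card padic"
proof (cases "x = 0")
  case False
  then have "padic_norm (1 / x) * padic_norm x = 1"
    by (simp add: padic_norm_1 flip: padic_norm_mult)
  then show ?thesis using padic_norm_pos[OF False] by (simp add: field_simps)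
qed simp

lemma padic_norm_eq_1_iff_val:
  fixes x :: "'p::prime_card padic"
  assumes "x \<noteq> 0"
  shows "padic_norm x = 1 \<longleftrightarrow> padic_val x = 0"
proof -
  have "real CARD('p) > 1" using pr_gt_1[where 'p='p] by simp
  from power_int_strict_increasing[OF _ this, of "- padic_val x" 0]
    power_int_strict_increasing[OF _ this, of 0 "- padic_val x"]
  show ?thesis using assms by (cases "padic_val x" "0::int" rule: linorder_cases) (auto simp: padic_norm_def)
qed

lemma of_rat_powi: "of_rat (x powi n) = (of_rat x :: 'a::field_char_0) powi n"
  by (simp add: power_int_def of_rat_power of_rat_inverse)

text \<open>
  A rational number whose denominator is a power of \<open>p\<close> has no other place where it could fail to be an
  integer: if its norm is at most \<open>1\<close>, the powers of \<open>p\<close> in the denominator cancel one at a time.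
\<close>

lemma rat_in_Ints_if_padic_norm_le_1:
  assumes "of_nat CARD('p) ^ j * r \<in> \<int>" "padic_norm (of_rat r :: 'p::prime_card padic) \<le> 1"
  shows "r \<in> \<int>"
  using assms
proof (induction j)
  case (Suc j)
  let ?p = "pr TYPE('p)"
  obtain m where m: "of_nat CARD('p) ^ Suc j * r = of_int m" using Suc.prems(1) by (elim Ints_cases)
  have "(of_int m :: 'p padic) = of_rat (of_nat CARD('p) ^ Suc j * r)" by (simp only: m of_rat_of_int_eq)
  also have "padic_norm \<dots> = (1 / real CARD('p)) ^ Suc j * padic_norm (of_rat r :: 'p padic)"
    by (simp only: of_rat_mult of_rat_power of_rat_of_nat_eq padic_norm_mult padic_norm_power padic_norm_of_nat_card)
  also have "\<dots> \<le> (1 / real CARD('p)) ^ Suc j * 1"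
    using Suc.prems(2) by (intro mult_left_mono) auto
  also have "\<dots> < 1" using pr_gt_1[where 'p='p] power_Suc_less_one[of "1 / real CARD('p)" j] by simp
  finally have "?p dvd m" using padic_norm_of_int_eq_1[of m, where 'p='p] by fastforce
  then obtain l where "m = ?p * l" by blast
  then have "of_nat CARD('p) * (of_nat CARD('p) ^ j * r) = of_nat CARD('p) * of_int l"
    using m by (simp add: mult.assoc)
  then have "of_nat CARD('p) ^ j * r = of_int l" by simp
  then show ?case using Suc by simp
qed simp

section \<open>The truncations $s$ and $t$\<close>

text \<open>
  The partial sums of the expansion beyond the exponent \<open>m\<close> differ from the truncation at \<open>m\<close> by multiples of
  \<open>p\<^sup>m\<^sup>+\<^sup>1\<close>; by the ultrametric inequality this estimate survives the limit. The truncations at \<open>0\<close> and \<open>- 1\<close>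
  are \<open>s\<close> and \<open>t\<close>.
\<close>

lemma padic_truncation:
  fixes x :: "'p::prime_card padic" and m :: int
  assumes "odd CARD('p)"
  defines "A \<equiv> {n. n \<le> m \<and> padic_digits x n \<noteq> 0}"
  shows "finite A"
    and "padic_norm (x - of_rat (\<Sum>n\<in>A. of_int (padic_digits x n) * of_nat CARD('p) powi n))
      \<le> real CARD('p) powi (- (m + 1))"
proof -
  let ?P = "of_nat CARD('p) :: 'p padic" and ?q = "real CARD('p)"
  have q: "?q > 1" using pr_gt_1[where 'p='p] by simp
  define f where "f = (\<lambda>n. of_int (padic_digits x n) * ?P powi n)"
  obtain r where r: "\<forall>n<r. padic_digits x n = 0"
    and lim: "(\<lambda>N. padic_norm (x - (\<Sum>n = r..int N. f n))) \<longlonglongrightarrow> 0"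
    using balanced_expansion_padic_digits[OF assms(1), of x]
    unfolding balanced_expansion_def f_def by blast
  have sub: "A \<subseteq> {r..m}" using r unfolding A_def by (auto simp: not_less[symmetric])
  then show "finite A" by (rule finite_subset) simp
  have rat: "of_rat (\<Sum>n\<in>A. of_int (padic_digits x n) * of_nat CARD('p) powi n) = (\<Sum>n\<in>A. f n)"
    by (simp add: of_rat_sum of_rat_mult of_rat_powi f_def)
  have "?q powi (- (m + 1)) > 0" using q by (intro zero_less_power_int) simp
  with lim have "\<forall>\<^sub>F N in sequentially. padic_norm (x - (\<Sum>n = r..int N. f n)) < ?q powi (- (m + 1))"
    by (rule order_tendstoD)
  moreover have "\<forall>\<^sub>F N in sequentially. int N \<ge> m"
    using eventually_ge_at_top[of "nat m"] by eventually_elim linarith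
  ultimately have "\<forall>\<^sub>F N in sequentially. padic_norm (x - (\<Sum>n\<in>A. f n)) \<le> ?q powi (- (m + 1))"
  proof eventually_elim
    case (elim N)
    let ?B = "{n. r \<le> n \<and> m < n \<and> n \<le> int N}"
    have fin: "finite ?B" by (rule finite_subset[of _ "{r..int N}"]) auto
    have "(\<Sum>n = r..int N. f n) = (\<Sum>n\<in>A \<union> ?B. f n)"
      using sub elim(2) by (intro sum.mono_neutral_right) (auto simp: A_def f_def)
    also have "\<dots> = (\<Sum>n\<in>A. f n) + (\<Sum>n\<in>?B. f n)"
      using \<open>finite A\<close> fin by (intro sum.union_disjoint) (auto simp: A_def)
    finally have split: "x - (\<Sum>n\<in>A. f n) = (x - (\<Sum>n = r..int N. f n)) + (\<Sum>n\<in>?B. f n)" by simp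
    have "padic_norm (\<Sum>n\<in>?B. f n) \<le> ?q powi (- (m + 1))"
    proof (rule padic_norm_sum_le[OF fin])
      fix n assume "n \<in> ?B"
      then have "?q powi (- n) \<le> ?q powi (- (m + 1))" using q by (intro power_int_increasing) auto
      moreover have "padic_norm (f n) \<le> 1 * ?q powi (- n)"
        unfolding f_def padic_norm_mult padic_norm_card_powi
        by (intro mult_right_mono padic_norm_of_int_le) (simp add: zero_le_power_int)
      ultimately show "padic_norm (f n) \<le> ?q powi (- (m + 1))" by simp
    qed (simp add: zero_le_power_int)
    then show ?case
      unfolding split
      using padic_norm_add[of "x - (\<Sum>n = r..int N. f n)" "\<Sum>n\<in>?B. f n"] elim(1) by linarith
  qed
  then show "padic_norm (x - of_rat (\<Sum>n\<in>A. of_int (padic_digits x n) * of_nat CARD('p) powi n))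
      \<le> ?q powi (- (m + 1))"
    unfolding rat by simp
qed

lemma browkin_s_close:
  fixes x :: "'p::prime_card padic"
  assumes "odd CARD('p)"
  shows "padic_norm (x - of_rat (browkin_s x)) \<le> 1 / real CARD('p)"
  using padic_truncation(2)[OF assms, of x 0] by (simp add: browkin_s_def power_int_minus divide_simps)

lemma browkin_t_close:
  fixes x :: "'p::prime_card padic"
  assumes "odd CARD('p)"
  shows "padic_norm (x - of_rat (browkin_t x)) \<le> 1"
proof -
  have "{n. n < 0 \<and> padic_digits x n \<noteq> 0} = {n. n \<le> - 1 \<and> padic_digits x n \<noteq> 0}" by auto
  then show ?thesis using padic_truncation(2)[OF assms, of x "- 1"] by (simp add: browkin_t_def)
qed

lemma two_abs_padic_digit_le:
  fixes x :: "'p::prime_card padic"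
  assumes "odd CARD('p)"
  shows "2 * \<bar>padic_digits x n\<bar> \<le> pr TYPE('p) - 1"
  using balanced_expansion_padic_digits[OF assms, of x] unfolding balanced_expansion_def by blast

text \<open>
  The real size of \<open>t\<close> is bounded by the geometric series \<open>(p - 1) / 2 \<cdot> (1/p + 1/p\<^sup>2 + \<dots>) = 1/2\<close>, which a finite
  sum does not reach.
\<close>

lemma browkin_t_bounds:
  fixes x :: "'p::prime_card padic"
  assumes "odd CARD('p)"
  shows "2 * \<bar>browkin_t x\<bar> < 1" and "\<exists>j. of_nat CARD('p) ^ j * browkin_t x \<in> \<int>"
proof -
  let ?p = "of_nat CARD('p) :: rat"
  define d where "d = padic_digits x"
  have p: "?p > 1" using pr_gt_1[where 'p='p] by simp
  obtain r where r: "\<forall>n<r. d n = 0"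
    using balanced_expansion_padic_digits[OF assms, of x] unfolding balanced_expansion_def d_def by blast
  \<comment> \<open>The sum is rewritten over the exponents \<open>- 1, \<dots>, - j\<close>; for \<open>r \<ge> 0\<close> it is empty.\<close>
  define j where "j = nat (- r)"
  define T where "T = (\<lambda>j. \<Sum>i=1..j. of_int (d (- int i)) / ?p ^ i)"
  have "browkin_t x = (\<Sum>n = - int j..-1. of_int (d n) * ?p powi n)"
    unfolding browkin_t_def d_def[symmetric] using r
    by (intro sum.mono_neutral_left) (auto simp: j_def not_less[symmetric])
  also have "\<dots> = T j"
    unfolding T_def
    by (rule sum.reindex_bij_witness[of _ "\<lambda>i. - int i" "\<lambda>n. nat (- n)"])
      (auto simp: power_int_def field_simps)
  finally have t: "browkin_t x = T j" .
  have T_Suc: "T (Suc i) = T i + of_int (d (- int (Suc i))) / ?p ^ Suc i" for i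
    by (simp add: T_def)
  have "2 * \<bar>T i\<bar> \<le> 1 - 1 / ?p ^ i" for i
  proof (induction i)
    case (Suc i)
    \<comment> \<open>The new term is at most half of \<open>(p - 1) / p\<^sup>i\<^sup>+\<^sup>1 = 1 / p\<^sup>i - 1 / p\<^sup>i\<^sup>+\<^sup>1\<close>.\<close>
    have "2 * \<bar>d (- int (Suc i))\<bar> \<le> pr TYPE('p) - 1"
      unfolding d_def by (rule two_abs_padic_digit_le[OF assms])
    then have "of_int (2 * \<bar>d (- int (Suc i))\<bar>) \<le> (of_int (pr TYPE('p) - 1) :: rat)"
      by (simp only: of_int_le_iff)
    then have "2 * \<bar>of_int (d (- int (Suc i))) :: rat\<bar> / ?p ^ Suc i \<le> (?p - 1) / ?p ^ Suc i"
      using p by (intro divide_right_mono) auto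
    also have "\<dots> = 1 / ?p ^ i - 1 / ?p ^ Suc i" using p by (simp add: field_simps)
    finally show ?case
      unfolding T_Suc using Suc.IH p
        abs_triangle_ineq[of "T i" "of_int (d (- int (Suc i))) / ?p ^ Suc i"]
      by (simp add: abs_divide)
  qed (simp add: T_def)
  moreover have "1 - 1 / ?p ^ j < 1" using p by simp
  ultimately show "2 * \<bar>browkin_t x\<bar> < 1" unfolding t by (rule order_le_less_trans)
  have "?p ^ i * T i \<in> \<int>" for i
  proof (induction i)
    case (Suc i)
    have "?p ^ Suc i * T (Suc i) = ?p * (?p ^ i * T i) + of_int (d (- int (Suc i)))"
      unfolding T_Suc using p by (simp add: field_simps)
    then show ?case using Suc.IH by (metis Ints_add Ints_mult Ints_of_int Ints_of_nat)
  qed (simp add: T_def)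
  then show "\<exists>j. ?p ^ j * browkin_t x \<in> \<int>" unfolding t by blast
qed

text \<open>
  For \<open>x\<close> in the ring of \<open>p\<close>-adic integers, \<open>t(x)\<close> is a \<open>p\<close>-adic integer as well. Its denominator being a
  power of \<open>p\<close>, it is an ordinary integer, and its real size below \<open>1/2\<close> forces it to vanish. Only the digit at exponent \<open>0\<close> is left of \<open>s(x)\<close>.
\<close>

lemma browkin_s_eq_digit:
  fixes x :: "'p::prime_card padic"
  assumes "odd CARD('p)" "padic_norm x \<le> 1"
  shows "browkin_s x = of_int (padic_digits x 0)"
proof -
  let ?A = "{n. n < 0 \<and> padic_digits x n \<noteq> 0}"
  have fin: "finite ?A"
    using padic_truncation(1)[OF assms(1), of 0 x] by (rule rev_finite_subset) auto
  have "of_rat (browkin_t x) = x + - (x - of_rat (browkin_t x))" by simp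
  then have "padic_norm (of_rat (browkin_t x) :: 'p padic)
      \<le> max (padic_norm x) (padic_norm (x - of_rat (browkin_t x)))"
    using padic_norm_add[of x "- (x - of_rat (browkin_t x))"] by (simp only: padic_norm_uminus)
  also have "\<dots> \<le> 1" using assms(2) browkin_t_close[OF assms(1), of x] by simp
  finally have le: "padic_norm (of_rat (browkin_t x) :: 'p padic) \<le> 1" .
  obtain j where "of_nat CARD('p) ^ j * browkin_t x \<in> \<int>"
    using browkin_t_bounds(2)[OF assms(1), of x] by blast
  then have "browkin_t x \<in> \<int>" using le by (rule rat_in_Ints_if_padic_norm_le_1)
  then have t: "browkin_t x = 0"
    using browkin_t_bounds(1)[OF assms(1), of x] by (elim Ints_cases) (auto simp flip: of_int_abs)
  show ?thesis
  proof (cases "padic_digits x 0 = 0")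
    case True
    then have "{n. n \<le> 0 \<and> padic_digits x n \<noteq> 0} = ?A" by (auto simp: order_le_less)
    then show ?thesis using t True by (simp add: browkin_s_def browkin_t_def)
  next
    case False
    then have "{n. n \<le> 0 \<and> padic_digits x n \<noteq> 0} = insert 0 ?A" by auto
    then show ?thesis using t fin by (simp add: browkin_s_def browkin_t_def)
  qed
qed


section \<open>Norms of complete and partial quotients\<close>

lemma browkin2_quot_Suc_mult:
  assumes "browkin2_infinite \<alpha>"
  shows "browkin2_quot \<alpha> (Suc n) * (browkin2_quot \<alpha> n - of_rat (browkin2_coeff \<alpha> n)) = 1"
  using assms by (auto simp: browkin2_infinite_def browkin2_coeff_def)

lemma padic_norm_browkin2_quot_Suc:
  "padic_norm (browkin2_quot \<alpha> (Suc n))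
    = 1 / padic_norm (browkin2_quot \<alpha> n - of_rat (browkin2_coeff \<alpha> n))"
  by (simp only: browkin2_quot.simps padic_norm_inverse browkin2_coeff_def)

lemma padic_norm_even_remainder:
  fixes \<alpha> :: "'p::prime_card padic"
  assumes "odd CARD('p)" "even n"
  shows "padic_norm (browkin2_quot \<alpha> n - of_rat (browkin2_coeff \<alpha> n)) \<le> 1 / real CARD('p)"
  using browkin_s_close[OF assms(1)] assms(2) by (simp add: browkin2_coeff_def browkin2_step_def)

lemma padic_norm_odd_quot:
  fixes \<alpha> :: "'p::prime_card padic"
  assumes "odd CARD('p)" "browkin2_infinite \<alpha>" "odd n"
  shows "padic_norm (browkin2_quot \<alpha> n) \<ge> real CARD('p)"
proof -
  obtain m where n: "n = Suc m" and "even m" using assms(3) by (cases n) auto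
  let ?r = "browkin2_quot \<alpha> m - of_rat (browkin2_coeff \<alpha> m)"
  have "?r \<noteq> 0" using assms(2) by (simp add: browkin2_infinite_def)
  then have "padic_norm ?r > 0" by (rule padic_norm_pos)
  moreover have "padic_norm ?r \<le> 1 / real CARD('p)"
    by (rule padic_norm_even_remainder[OF assms(1) \<open>even m\<close>])
  ultimately show ?thesis
    using pr_gt_1[where 'p='p] unfolding n padic_norm_browkin2_quot_Suc by (simp add: field_simps)
qed

text \<open>
  If \<open>x - t(x)\<close> has norm less than \<open>1\<close>, adding \<open>\<plusminus>1\<close> turns it into a unit, which is the purpose of the sign
  correction. As \<open>0 < |t| < 1/2\<close> in real size, subtracting the sign of \<open>t\<close> yields the real size \<open>1 - |t| < 1\<close>.
\<close>

lemma browkin2_step_odd: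
  fixes x :: "'p::prime_card padic"
  assumes "odd CARD('p)" "odd n" "padic_norm x > 1"
  shows "padic_norm (x - of_rat (browkin2_step n x)) = 1"
    and "\<bar>browkin2_step n x\<bar> < 1"
    and "\<exists>j. of_nat CARD('p) ^ j * browkin2_step n x \<in> \<int>"
proof -
  define t where "t = browkin_t x"
  define b where "b = browkin2_step n x"
  have close: "padic_norm (x - of_rat t) \<le> 1"
    unfolding t_def by (rule browkin_t_close[OF assms(1)])
  then have "padic_norm (of_rat t :: 'p padic) = padic_norm x"
    using assms(3) by (intro padic_norm_eq_if_diff_less) (simp add: padic_norm_diff_commute)
  then have t0: "t \<noteq> 0" using assms(3) by auto
  have small: "2 * \<bar>t\<bar> < 1" unfolding t_def by (rule browkin_t_bounds(1)[OF assms(1)])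
  obtain j where j: "of_nat CARD('p) ^ j * t \<in> \<int>"
    using browkin_t_bounds(2)[OF assms(1)] unfolding t_def by blast
  have sgn_Ints: "sgn t \<in> \<int>" by (simp add: sgn_if)
  have "padic_norm (x - of_rat b) = 1 \<and> \<bar>b\<bar> < 1 \<and> (\<exists>j. of_nat CARD('p) ^ j * b \<in> \<int>)"
  proof (cases "x \<noteq> of_rat t \<and> padic_val (x - of_rat t) = 0")
    case True
    then have "b = t" using assms(2) by (simp add: b_def t_def browkin2_step_def)
    then show ?thesis using True small j padic_norm_eq_1_iff_val[of "x - of_rat t"] by auto
  next
    case False
    then have b: "b = t - sgn t" using assms(2) by (auto simp: b_def t_def browkin2_step_def)
    have "padic_norm (x - of_rat t) \<noteq> 1"
      using False padic_norm_eq_1_iff_val[of "x - of_rat t"] by (cases "x = of_rat t") auto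
    then have "padic_norm (x - of_rat t) < 1" using close by simp
    moreover have "padic_norm (of_rat (sgn t) :: 'p padic) = 1"
      using t0 by (simp add: sgn_if padic_norm_1 of_rat_minus)
    moreover have "x - of_rat b = (x - of_rat t) + of_rat (sgn t)"
      by (simp add: b of_rat_diff)
    ultimately have "padic_norm (x - of_rat b) = 1"
      using padic_norm_add_eq_right[of "x - of_rat t" "of_rat (sgn t)"] by (simp only:)
    moreover have "\<bar>b\<bar> < 1" using small t0 by (auto simp: b sgn_if abs_if split: if_splits)
    moreover have "of_nat CARD('p) ^ j * b \<in> \<int>"
      unfolding b right_diff_distrib
      by (rule Ints_diff[OF j Ints_mult[OF Ints_power[OF Ints_of_nat] sgn_Ints]])
    ultimately show ?thesis by auto
  qed
  then show "padic_norm (x - of_rat (browkin2_step n x)) = 1" "\<bar>browkin2_step n x\<bar> < 1"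
    "\<exists>j. of_nat CARD('p) ^ j * browkin2_step n x \<in> \<int>" unfolding b_def by blast+
qed

lemma browkin2_coeff_odd:
  fixes \<alpha> :: "'p::prime_card padic"
  assumes "odd CARD('p)" "browkin2_infinite \<alpha>" "odd n"
  shows "padic_norm (browkin2_quot \<alpha> n - of_rat (browkin2_coeff \<alpha> n)) = 1"
    and "\<bar>browkin2_coeff \<alpha> n\<bar> < 1"
    and "\<exists>j. of_nat CARD('p) ^ j * browkin2_coeff \<alpha> n \<in> \<int>"
proof -
  have "padic_norm (browkin2_quot \<alpha> n) > 1"
    using padic_norm_odd_quot[OF assms] pr_gt_1[where 'p='p] by simp
  from browkin2_step_odd[OF assms(1,3) this]
  show "padic_norm (browkin2_quot \<alpha> n - of_rat (browkin2_coeff \<alpha> n)) = 1"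
    and "\<bar>browkin2_coeff \<alpha> n\<bar> < 1"
    and "\<exists>j. of_nat CARD('p) ^ j * browkin2_coeff \<alpha> n \<in> \<int>"
    unfolding browkin2_coeff_def .
qed

lemma padic_norm_even_quot:
  fixes \<alpha> :: "'p::prime_card padic"
  assumes "odd CARD('p)" "browkin2_infinite \<alpha>" "even n" "n > 0"
  shows "padic_norm (browkin2_quot \<alpha> n) = 1"
proof -
  obtain m where n: "n = Suc m" and "odd m" using assms(3,4) by (cases n) auto
  then show ?thesis
    unfolding n padic_norm_browkin2_quot_Suc using browkin2_coeff_odd(1)[OF assms(1,2)] by simp
qed

lemma padic_norm_coeff_eq_quot:
  fixes \<alpha> :: "'p::prime_card padic"
  assumes "odd CARD('p)" "browkin2_infinite \<alpha>" "n > 0 \<or> padic_norm \<alpha> = 1"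
  shows "padic_norm (of_rat (browkin2_coeff \<alpha> n) :: 'p padic) = padic_norm (browkin2_quot \<alpha> n)"
proof -
  have p: "real CARD('p) > 1" using pr_gt_1[where 'p='p] by simp
  have "padic_norm (browkin2_quot \<alpha> n - of_rat (browkin2_coeff \<alpha> n)) < padic_norm (browkin2_quot \<alpha> n)"
  proof (cases "even n")
    case True
    have "padic_norm (browkin2_quot \<alpha> n) = 1"
      using padic_norm_even_quot[OF assms(1,2) True] assms(3) by (cases "n = 0") simp_all
    moreover have "1 / real CARD('p) < 1" using p by simp
    ultimately show ?thesis
      using padic_norm_even_remainder[OF assms(1) True, of \<alpha>] by linarith
  next
    case False
    then show ?thesis
      using p padic_norm_odd_quot[OF assms(1,2)] browkin2_coeff_odd(1)[OF assms(1,2)] by fastforce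
  qed
  then show ?thesis using padic_norm_eq_if_diff_less by metis
qed

section \<open>Rational numbers have finite expansions\<close>

text \<open>
  With \<open>\<alpha>\<^sub>n = u / w\<close> the Euclidean step gives \<open>u - b\<^sub>n w\<close> and \<open>w - b\<^sub>n\<^sub>+\<^sub>1 (u - b\<^sub>n w)\<close>, and the quotient of these is \<open>\<alpha>\<^sub>n\<^sub>+\<^sub>2\<close>.
  Both are divisible by \<open>p\<close> in the ring of \<open>p\<close>-adic integers, while in real size they grow by a factor below \<open>p\<close>,
  since \<open>1 + (p - 1) / 2 < p\<close> and \<open>2 + (p - 1) / 2 \<le> p\<close>. After division by \<open>p\<close> they are integers smaller than before.
\<close>

lemma rational_even_quot_descent:
  fixes \<alpha> :: "'p::prime_card padic" and u w :: int
  assumes "odd CARD('p)" "browkin2_infinite \<alpha>" "even n" "n > 0"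
    and "w \<noteq> 0" "of_int u = browkin2_quot \<alpha> n * of_int w"
  shows "\<exists>u' w'. w' \<noteq> 0 \<and> of_int u' = browkin2_quot \<alpha> (n + 2) * of_int w' \<and>
    max \<bar>u'\<bar> \<bar>w'\<bar> < max \<bar>u\<bar> \<bar>w\<bar>"
proof -
  let ?p = "pr TYPE('p)"
  define N where "N = max \<bar>u\<bar> \<bar>w\<bar>"
  define x y z where "x = browkin2_quot \<alpha> n" and "y = browkin2_quot \<alpha> (Suc n)"
    and "z = browkin2_quot \<alpha> (n + 2)"
  define a where "a = padic_digits x 0"
  define b where "b = browkin2_coeff \<alpha> (Suc n)"
  have p3: "?p \<ge> 3" using pr_gt_1[where 'p='p] assms(1) by (cases "CARD('p) = 2") auto
  have x1: "padic_norm x = 1" unfolding x_def by (rule padic_norm_even_quot[OF assms(1-4)])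
  then have coeff: "browkin2_coeff \<alpha> n = of_int a"
    using assms(3) browkin_s_eq_digit[OF assms(1), of x]
    by (simp add: browkin2_coeff_def browkin2_step_def a_def x_def)
  have a: "2 * \<bar>a\<bar> \<le> ?p - 1" unfolding a_def by (rule two_abs_padic_digit_le[OF assms(1)])
  have rem: "padic_norm (x - of_int a) \<le> 1 / real CARD('p)"
    using padic_norm_even_remainder[OF assms(1,3), of \<alpha>] by (simp add: coeff x_def)
  have yx: "y * (x - of_int a) = 1"
    using browkin2_quot_Suc_mult[OF assms(2), of n] by (simp only: coeff x_def y_def of_rat_of_int_eq)
  have zy: "z * (y - of_rat b) = 1"
    using browkin2_quot_Suc_mult[OF assms(2), of "Suc n"] by (simp only: y_def z_def b_def add_2_eq_Suc')
  have z1: "padic_norm z = 1" unfolding z_def by (rule padic_norm_even_quot) (use assms in auto)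
  have b1: "\<bar>b\<bar> < 1" unfolding b_def by (rule browkin2_coeff_odd(2)) (use assms in auto)
  obtain j where j: "of_nat CARD('p) ^ j * b \<in> \<int>"
    using browkin2_coeff_odd(3)[OF assms(1,2), of "Suc n"] assms(3) unfolding b_def by auto

  have diff: "of_int (u - a * w) = (x - of_int a) * (of_int w :: 'p padic)"
    using assms(6) by (simp add: x_def algebra_simps)
  have "padic_norm (of_int (u - a * w) :: 'p padic) \<le> (1 / real CARD('p)) * 1"
    unfolding diff padic_norm_mult
    by (intro mult_mono rem padic_norm_of_int_le padic_norm_nonneg) simp
  also have "\<dots> < 1" using pr_gt_1[where 'p='p] by simp
  finally have "?p dvd u - a * w" using padic_norm_of_int_eq_1[of "u - a * w", where 'p='p] by fastforce
  then obtain u' where u': "u - a * w = ?p * u'" by blast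
  have w: "of_int w = y * of_nat CARD('p) * (of_int u' :: 'p padic)"
  proof -
    have "of_int w = y * of_int (u - a * w)" using yx unfolding diff by (simp flip: mult.assoc)
    then show ?thesis unfolding u' by simp
  qed
  then have u'0: "u' \<noteq> 0" using assms(5) by auto

  \<comment> \<open>\<open>r\<close> is the second member of the Euclidean step divided by \<open>p\<close>. Its denominator is a power of \<open>p\<close>, and
    \<open>u' = \<alpha>\<^sub>n\<^sub>+\<^sub>2 r\<close> with \<open>|\<alpha>\<^sub>n\<^sub>+\<^sub>2| = 1\<close> bounds its norm, so it is an integer.\<close>
  define r where "r = of_int w / of_nat CARD('p) - b * of_int u'"
  have "of_rat r = (y - of_rat b) * (of_int u' :: 'p padic)"
    by (simp add: r_def of_rat_diff of_rat_divide of_rat_mult w algebra_simps)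
  then have zr: "of_int u' = z * of_rat r" using zy by (simp flip: mult.assoc)
  have "padic_norm (of_rat r :: 'p padic) \<le> 1"
    using arg_cong[OF zr, of padic_norm] padic_norm_of_int_le[of u', where 'p='p]
    by (simp add: padic_norm_mult z1)
  moreover have "of_nat CARD('p) ^ Suc j * r \<in> \<int>"
  proof -
    have "of_nat CARD('p) ^ Suc j * r
        = of_nat CARD('p) ^ j * of_int w - of_nat CARD('p) * (of_nat CARD('p) ^ j * b) * of_int u'"
      by (simp add: r_def field_simps)
    then show ?thesis using j by (auto intro!: Ints_diff Ints_mult Ints_power)
  qed
  ultimately have "r \<in> \<int>" by (rule rat_in_Ints_if_padic_norm_le_1[rotated])
  then obtain w' where w': "r = of_int w'" by (rule Ints_cases)
  have zw: "of_int u' = z * of_int w'" using zr by (simp add: w')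
  then have "w' \<noteq> 0" using u'0 by auto

  \<comment> \<open>From here on absolute values are real: \<open>|a| \<le> (p - 1) / 2\<close>, \<open>|b| < 1\<close> and \<open>p \<ge> 3\<close> make both entries shrink.\<close>
  have le: "\<bar>u\<bar> \<le> N" "\<bar>w\<bar> \<le> N" "N \<ge> 1" using assms(5) by (auto simp: N_def)
  have "2 * \<bar>a * w\<bar> \<le> (?p - 1) * N"
    unfolding abs_mult using mult_mono[OF a le(2)] le(3) by simp
  then have d: "2 * \<bar>u - a * w\<bar> \<le> (?p + 1) * N"
    using abs_triangle_ineq4[of u "a * w"] le by (simp add: algebra_simps)
  have "2 * (?p * \<bar>u'\<bar>) \<le> (?p + 1) * N" using d by (simp add: u' abs_mult)
  also have "\<dots> < 2 * (?p * N)" using p3 le(3) by (simp add: algebra_simps)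
  finally have u'N: "\<bar>u'\<bar> < N" by simp
  have "of_int (?p * w') = of_int w - b * (of_int (u - a * w) :: rat)"
    using w' by (simp add: r_def u' field_simps)
  then have "\<bar>of_int (?p * w') :: rat\<bar> \<le> of_int \<bar>w\<bar> + \<bar>b\<bar> * of_int \<bar>u - a * w\<bar>"
    using abs_triangle_ineq4[of "of_int w" "b * (of_int (u - a * w) :: rat)"]
    by (simp add: abs_mult)
  also have "\<dots> < of_int \<bar>w\<bar> + 1 * of_int \<bar>u - a * w\<bar>"
    using b1 u'0 unfolding u' by (intro add_strict_left_mono mult_strict_right_mono) auto
  also have "\<dots> = of_int (\<bar>w\<bar> + \<bar>u - a * w\<bar>)" by simp
  finally have "\<bar>?p * w'\<bar> < \<bar>w\<bar> + \<bar>u - a * w\<bar>" by (simp only: of_int_less_iff flip: of_int_abs)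
  then have "2 * (?p * \<bar>w'\<bar>) < (?p + 3) * N"
    using d le(2) by (simp add: abs_mult algebra_simps)
  also have "\<dots> \<le> 2 * (?p * N)"
    using mult_right_mono[of 3 ?p N] p3 le(3) by (simp add: algebra_simps)
  finally have "\<bar>w'\<bar> < N" by simp
  with u'N zw \<open>w' \<noteq> 0\<close> show ?thesis unfolding N_def z_def by auto
qed

lemma browkin2_infinite_imp_irrational:
  fixes \<alpha> :: "'p::prime_card padic"
  assumes "odd CARD('p)" "browkin2_infinite \<alpha>"
  shows "\<alpha> \<notin> range of_rat"
proof
  assume "\<alpha> \<in> range of_rat"
  then obtain a where a: "\<alpha> = of_rat a" by blast
  have no_fraction: "\<not> (w \<noteq> 0 \<and> of_int u = browkin2_quot \<alpha> n * of_int w)"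
    if "even n" "n > 0" for n and u w :: int
    using that
  proof (induction "nat (max \<bar>u\<bar> \<bar>w\<bar>)" arbitrary: n u w rule: less_induct)
    case less
    show ?case
    proof
      assume "w \<noteq> 0 \<and> of_int u = browkin2_quot \<alpha> n * of_int w"
      then obtain u' w' where smaller: "w' \<noteq> 0 \<and> of_int u' = browkin2_quot \<alpha> (n + 2) * of_int w'"
        and less_max: "max \<bar>u'\<bar> \<bar>w'\<bar> < max \<bar>u\<bar> \<bar>w\<bar>"
        using rational_even_quot_descent[OF assms less.prems] by blast
      have "nat (max \<bar>u'\<bar> \<bar>w'\<bar>) < nat (max \<bar>u\<bar> \<bar>w\<bar>)" using less_max by linarith
      then have "\<not> (w' \<noteq> 0 \<and> of_int u' = browkin2_quot \<alpha> (n + 2) * of_int w')"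
        by (rule less.hyps) (use less.prems in auto)
      with smaller show False by contradiction
    qed
  qed
  have "browkin2_quot \<alpha> n \<in> range of_rat" for n
  proof (induction n)
    case (Suc n)
    then obtain r where "browkin2_quot \<alpha> n = of_rat r" by blast
    then have "browkin2_quot \<alpha> (Suc n) = of_rat (1 / (r - browkin2_coeff \<alpha> n))"
      by (simp add: browkin2_coeff_def of_rat_divide of_rat_diff)
    then show ?case by blast
  qed (simp add: a)
  \<comment> \<open>The descent starts at index \<open>2\<close>, since \<open>\<alpha>\<close> itself may have any norm.\<close>
  then obtain r where r: "browkin2_quot \<alpha> 2 = of_rat r" by blast
  obtain u w where "quotient_of r = (u, w)" by fastforce
  then have "r = of_int u / of_int w" "w \<noteq> 0"
    using quotient_of_div quotient_of_denom_pos[of r] by (auto dest: quotient_of_div)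
  then have "of_int u = browkin2_quot \<alpha> 2 * of_int w" by (simp add: r of_rat_divide)
  with \<open>w \<noteq> 0\<close> show False using no_fraction[of 2 w u] by simp
qed

section \<open>Periodic expansions and their fixed point equation\<close>

text \<open>
  Consecutive distances \<open>d\<^sub>n = |\<alpha>\<^sub>n\<^sub>+\<^sub>k - \<alpha>\<^sub>n|\<close> satisfy \<open>d\<^sub>n\<^sub>+\<^sub>1 = d\<^sub>n |\<alpha>\<^sub>n\<^sub>+\<^sub>1| |\<alpha>\<^sub>n\<^sub>+\<^sub>1\<^sub>+\<^sub>k|\<close>, because the partial quotients cancel.
  So \<open>d\<^sub>n\<^sub>+\<^sub>2 \<ge> p d\<^sub>n\<close> for even \<open>n\<close>. As remainders have norm at most \<open>1\<close>, these \<open>d\<^sub>n\<close> are bounded, whence \<open>d\<^sub>0 = 0\<close>.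
\<close>

lemma browkin2_quot_periodic:
  fixes \<alpha> :: "'p::prime_card padic"
  assumes "odd CARD('p)" "browkin2_infinite \<alpha>" "even k"
    and per: "\<And>n. browkin2_coeff \<alpha> (n + k) = browkin2_coeff \<alpha> n"
  shows "browkin2_quot \<alpha> k = \<alpha>"
proof -
  define x where "x = browkin2_quot \<alpha>"
  define d where "d = (\<lambda>n. padic_norm (x (n + k) - x n))"
  let ?q = "real CARD('p)"
  have q: "?q > 1" using pr_gt_1[where 'p='p] by simp
  have step: "d (Suc n) = d n * (padic_norm (x (Suc n)) * padic_norm (x (Suc n + k)))" for n
  proof -
    define b :: "'p padic" where "b = of_rat (browkin2_coeff \<alpha> n)"
    have e: "x (Suc n) * (x n - b) = 1" "x (Suc n + k) * (x (n + k) - b) = 1"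
      using browkin2_quot_Suc_mult[OF assms(2), of n] browkin2_quot_Suc_mult[OF assms(2), of "n + k"]
      by (simp_all only: per x_def b_def add_Suc)
    have "x (Suc n + k) - x (Suc n)
        = (x (Suc n) * (x n - b)) * x (Suc n + k) - (x (Suc n + k) * (x (n + k) - b)) * x (Suc n)"
      by (simp only: e mult_1)
    also have "\<dots> = - ((x (n + k) - x n) * (x (Suc n) * x (Suc n + k)))"
      by (simp add: algebra_simps)
    finally show ?thesis by (simp only: d_def padic_norm_uminus padic_norm_mult)
  qed
  have bound: "d n \<le> 1" if "even n" for n
  proof -
    have rem: "padic_norm (x m - of_rat (browkin2_coeff \<alpha> m)) \<le> 1" if "even m" for m
    proof -
      have "1 / ?q \<le> 1" using q by simp
      then show ?thesis using padic_norm_even_remainder[OF assms(1) that, of \<alpha>]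
        unfolding x_def by (rule order_trans[rotated])
    qed
    have "x (n + k) - x n = (x (n + k) - of_rat (browkin2_coeff \<alpha> (n + k)))
        + - (x n - of_rat (browkin2_coeff \<alpha> n))"
      by (simp add: per)
    then show ?thesis
      using padic_norm_add[of "x (n + k) - of_rat (browkin2_coeff \<alpha> (n + k))"
          "- (x n - of_rat (browkin2_coeff \<alpha> n))"] rem[of n] rem[of "n + k"] that assms(3)
      unfolding d_def padic_norm_uminus by (simp add: max_def split: if_splits)
  qed
  have contraction: "d n \<le> (1 / ?q) ^ m" if "even n" for m n
    using that
  proof (induction m arbitrary: n)
    case 0
    then show ?case using bound by simp
  next
    case (Suc m)
    have big: "padic_norm (x (Suc n)) \<ge> ?q" "padic_norm (x (Suc n + k)) \<ge> 1"
      using padic_norm_odd_quot[OF assms(1,2), of "Suc n"]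
        padic_norm_odd_quot[OF assms(1,2), of "Suc n + k"] Suc.prems assms(3) q
      by (simp_all add: x_def)
    have "d n * (?q * 1) \<le> d (Suc n)"
      unfolding step[of n] using big q
      by (intro mult_left_mono mult_mono) (auto simp: d_def padic_norm_nonneg)
    also have "\<dots> = d (n + 2)"
      using step[of "Suc n"] padic_norm_even_quot[OF assms(1,2), of "n + 2"]
        padic_norm_even_quot[OF assms(1,2), of "n + 2 + k"] Suc.prems assms(3)
      by (simp add: x_def)
    also have "\<dots> \<le> (1 / ?q) ^ m" using Suc by simp
    finally show ?case using q by (simp add: field_simps)
  qed
  have "d 0 \<le> 0"
  proof (rule LIMSEQ_le_const)
    show "(\<lambda>m. (1 / ?q) ^ m) \<longlonglongrightarrow> 0" using q by (intro LIMSEQ_power_zero) simp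
  qed (use contraction[of 0] in auto)
  then have "x k - x 0 = 0" using padic_norm_pos[of "x k - x 0"] by (force simp: d_def)
  then show ?thesis by (simp add: x_def)
qed

text \<open>
  Substituting \<open>x = r + 1 / y\<close> and \<open>y = s + 1 / z\<close> into \<open>\<alpha> = (a x + b) / (c x + d)\<close> acts on each of the rows
  \<open>(a, b)\<close> and \<open>(c, d)\<close> separately, by the recursion of continuants.
\<close>

lemma moebius_two_steps:
  fixes \<alpha> x y z :: "'a::field"
  assumes "\<alpha> * (c * x + d) = a * x + b"
    and "y * (x - r) = 1" "z * (y - s) = 1"
  shows "\<alpha> * (((c * r + d) * s + c) * z + (c * r + d)) = ((a * r + b) * s + a) * z + (a * r + b)"
proof -
  have xyz: "x * y = r * y + 1" "y * z = s * z + 1"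
    using assms(2,3) by (simp_all add: algebra_simps)
  have row: "(c * x + d) * (y * z) = ((c * r + d) * s + c) * z + (c * r + d)" for c d
  proof -
    have "(c * x + d) * (y * z) = c * (x * y) * z + d * (y * z)" by (simp add: algebra_simps)
    also have "\<dots> = (c * r + d) * (y * z) + c * z" by (simp add: xyz(1) algebra_simps)
    finally show ?thesis by (simp add: xyz(2) algebra_simps)
  qed
  show ?thesis using arg_cong[OF assms(1), of "\<lambda>t. t * (y * z)"] by (simp only: mult.assoc row)
qed

text \<open>
  In both sums of the continuant recursion the first summand dominates.
\<close>

lemma padic_norm_continuant_row:
  fixes a b r s :: "'p::prime_card padic"
  assumes "padic_norm b < padic_norm a" "padic_norm r = 1" "padic_norm s > 1"
  shows "padic_norm (a * r + b) = padic_norm a"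
    and "padic_norm ((a * r + b) * s + a) = padic_norm a * padic_norm s"
proof -
  show *: "padic_norm (a * r + b) = padic_norm a"
    using padic_norm_add_eq_right[of b "a * r"] assms by (simp add: padic_norm_mult add.commute)
  have "padic_norm a > 0" using assms(1) padic_norm_nonneg[of b] by simp
  then have "padic_norm a < padic_norm ((a * r + b) * s)"
    using assms(3) by (simp add: padic_norm_mult *)
  then show "padic_norm ((a * r + b) * s + a) = padic_norm a * padic_norm s"
    using padic_norm_add_eq_right[of a "(a * r + b) * s"] * by (simp add: padic_norm_mult add.commute[of a])
qed

text \<open>
  Starting from the identity matrix, one pair of steps produces the rows \<open>(b\<^sub>0 b\<^sub>1 + 1, b\<^sub>0)\<close> and \<open>(b\<^sub>1, 1)\<close>, whose
  norms agree entrywise because \<open>|b\<^sub>0| = 1\<close>. Each further pair of steps changes the norms of both rows in the same way.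
\<close>

lemma browkin2_quot_moebius:
  fixes \<alpha> :: "'p::prime_card padic"
  assumes "odd CARD('p)" "browkin2_infinite \<alpha>" "padic_norm \<alpha> = 1"
  shows "\<exists>a b c d. \<alpha> * (of_rat c * browkin2_quot \<alpha> (2 * Suc m) + of_rat d)
      = of_rat a * browkin2_quot \<alpha> (2 * Suc m) + of_rat b \<and>
    padic_norm (of_rat b :: 'p padic) < padic_norm (of_rat a :: 'p padic) \<and>
    padic_norm (of_rat c :: 'p padic) = padic_norm (of_rat a :: 'p padic) \<and>
    padic_norm (of_rat d :: 'p padic) = padic_norm (of_rat b :: 'p padic)"
proof -
  have p: "real CARD('p) > 1" using pr_gt_1[where 'p='p] by simp
  define x where "x = browkin2_quot \<alpha>"
  define b where "b = browkin2_coeff \<alpha>"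
  have x0: "x 0 = \<alpha>" by (simp add: x_def)
  have step: "x (Suc n) * (x n - of_rat (b n)) = 1" for n
    unfolding x_def b_def by (rule browkin2_quot_Suc_mult[OF assms(2)])
  have norm_b: "padic_norm (of_rat (b n) :: 'p padic) = padic_norm (x n)" for n
    unfolding b_def x_def by (rule padic_norm_coeff_eq_quot) (use assms in auto)
  have even: "padic_norm (of_rat (b n) :: 'p padic) = 1" if "even n" for n
    using padic_norm_even_quot[OF assms(1,2) that] assms(3) norm_b[of n]
    by (cases "n = 0") (simp_all add: x_def)
  have odd: "padic_norm (of_rat (b n) :: 'p padic) > 1" if "odd n" for n
    using padic_norm_odd_quot[OF assms(1,2) that] p norm_b[of n] by (simp add: x_def)
  show ?thesis
    unfolding x_def[symmetric]
  proof (induction m)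
    case 0
    have "\<alpha> * (((0 * of_rat (b 0) + 1) * of_rat (b 1) + 0) * x 2 + (0 * of_rat (b 0) + 1))
      = ((1 * of_rat (b 0) + 0) * of_rat (b 1) + 1) * x 2 + (1 * of_rat (b 0) + 0)"
      by (rule moebius_two_steps[where x = "x 0" and y = "x 1"])
        (use step[of 0] step[of 1] x0 in \<open>simp_all add: numeral_2_eq_2\<close>)
    then have "\<alpha> * (of_rat (b 1) * x (2 * Suc 0) + of_rat 1)
      = of_rat (b 0 * b 1 + 1) * x (2 * Suc 0) + of_rat (b 0)"
      by (simp add: of_rat_add of_rat_mult)
    moreover have "padic_norm (of_rat (b 0 * b 1 + 1) :: 'p padic) = padic_norm (of_rat (b 1) :: 'p padic)"
      using padic_norm_continuant_row(2)[of 0 1 "of_rat (b 0) :: 'p padic" "of_rat (b 1)"] even[of 0] odd[of 1]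
      by (simp add: padic_norm_1 of_rat_add of_rat_mult)
    moreover have "padic_norm (of_rat (b 0) :: 'p padic) = 1" using even[of 0] by simp
    moreover have "padic_norm (of_rat (b 1) :: 'p padic) > 1" using odd[of 1] by simp
    ultimately show ?case
      by (intro exI[of _ "b 0 * b 1 + 1"] exI[of _ "b 0"] exI[of _ "b 1"] exI[of _ 1])
        (simp add: padic_norm_1)
  next
    case (Suc m)
    then obtain a0 b0 c0 d0 where
      eq: "\<alpha> * (of_rat c0 * x (2 * Suc m) + of_rat d0) = of_rat a0 * x (2 * Suc m) + of_rat b0"
      and norms: "padic_norm (of_rat b0 :: 'p padic) < padic_norm (of_rat a0 :: 'p padic)"
        "padic_norm (of_rat c0 :: 'p padic) = padic_norm (of_rat a0 :: 'p padic)"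
        "padic_norm (of_rat d0 :: 'p padic) = padic_norm (of_rat b0 :: 'p padic)"
      by blast
    define n where "n = 2 * Suc m"
    have n: "2 * Suc (Suc m) = Suc (Suc n)" by (simp add: n_def)
    define r s where "r = b n" and "s = b (Suc n)"
    have rs: "padic_norm (of_rat r :: 'p padic) = 1" "padic_norm (of_rat s :: 'p padic) > 1"
      unfolding r_def s_def by (rule even, simp add: n_def) (rule odd, simp add: n_def)
    note ab = padic_norm_continuant_row[OF norms(1) rs]
    have "padic_norm (of_rat d0 :: 'p padic) < padic_norm (of_rat c0 :: 'p padic)"
      using norms by simp
    note cd = padic_norm_continuant_row[OF this rs]
    have "padic_norm (of_rat a0 :: 'p padic) > 0"
      using norms(1) padic_norm_nonneg[of "of_rat b0 :: 'p padic"] by simp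
    then have "padic_norm (of_rat a0 :: 'p padic)
        < padic_norm (of_rat a0 :: 'p padic) * padic_norm (of_rat s :: 'p padic)"
      using rs(2) by simp
    then show ?case
      unfolding n
      using moebius_two_steps[OF eq[folded n_def] step[of n, folded r_def] step[of "Suc n", folded s_def]]
      by (intro exI[of _ "(a0 * r + b0) * s + a0"] exI[of _ "a0 * r + b0"]
          exI[of _ "(c0 * r + d0) * s + c0"] exI[of _ "c0 * r + d0"])
        (simp only: of_rat_add of_rat_mult ab cd norms simp_thms)
  qed
qed

section \<open>Conjugates of irrational quadratic numbers\<close>

lemma rational_linear_relation_trivial:
  fixes \<alpha> :: "'a::field_char_0"
  assumes "\<alpha> \<notin> range of_rat" "of_rat u * \<alpha> + of_rat v = 0"
  shows "u = 0 \<and> v = 0"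
proof (cases "u = 0")
  case False
  then have "\<alpha> = of_rat (- v / u)"
    using assms(2) by (simp add: of_rat_divide of_rat_minus field_simps add_eq_0_iff)
  then show ?thesis using assms(1) by blast
qed (use assms(2) in simp)

lemma irreducible_quadraticI:
  fixes f :: "'a::field poly"
  assumes "degree f = 2" "\<And>r. poly f r \<noteq> 0"
  shows "irreducible f"
proof (rule irreducibleI)
  show "f \<noteq> 0" using assms(1) by auto
  then show "\<not> is_unit f" using assms(1) by (simp add: is_unit_iff_degree)
  fix g h assume f: "f = g * h"
  then have gh: "g \<noteq> 0" "h \<noteq> 0" using \<open>f \<noteq> 0\<close> by auto
  have no_linear: "degree l \<noteq> 1" if "l dvd f" for l
  proof
    assume "degree l = 1"
    then obtain u v where l: "l = [:u, v:]" "v \<noteq> 0" by (rule degree1_coeffs)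
    then have "poly l (- u / v) = 0" by simp
    then show False using that assms(2) by (metis dvd_trans poly_eq_0_iff_dvd)
  qed
  have "degree g + degree h = 2" using assms(1) gh by (simp add: f degree_mult_eq)
  then show "is_unit g \<or> is_unit h"
    using no_linear[of g] no_linear[of h] gh by (auto simp: f is_unit_iff_degree)
qed

lemma map_poly_of_rat_quadratic:
  assumes "c \<noteq> 0"
  shows "poly (map_poly of_rat [:g, e, c:]) x = of_rat g + of_rat e * x + of_rat c * x ^ 2"
  using assms by (simp add: map_poly_pCons power2_eq_square algebra_simps)

text \<open>
  By irrationality, every rational quadratic polynomial with root \<open>\<alpha>\<close> is proportional to \<open>c X\<^sup>2 + e X + g\<close>, so it
  has the same product of roots. Conversely the number \<open>\<beta>\<close> with that product is a root, and a rational root would, on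
  division by its linear factor, leave a rational linear equation for \<open>\<alpha>\<close>.
\<close>

lemma quadratic_conjugate_of_irrational_root:
  fixes \<alpha> \<beta> :: "'a::field_char_0"
  assumes "\<alpha> \<notin> range of_rat" "c \<noteq> 0"
    and root: "of_rat c * \<alpha> ^ 2 + of_rat e * \<alpha> + of_rat g = 0"
  shows "quadratic_conjugate \<alpha> \<beta> \<longleftrightarrow>
    \<beta> \<noteq> \<alpha> \<and> \<alpha> * \<beta> = of_rat (g / c)"
proof
  assume "quadratic_conjugate \<alpha> \<beta>"
  then obtain f where f: "degree f = 2" "poly (map_poly of_rat f) \<alpha> = 0" "poly (map_poly of_rat f) \<beta> = 0"
    and neq: "\<beta> \<noteq> \<alpha>" unfolding quadratic_conjugate_def by blast
  obtain c' e' g' where "f = [:g', e', c':]" and c': "c' \<noteq> 0" using f(1) by (rule degree2_coeffs)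
  then have roots: "of_rat g' + of_rat e' * \<alpha> + of_rat c' * \<alpha> ^ 2 = 0"
    "of_rat g' + of_rat e' * \<beta> + of_rat c' * \<beta> ^ 2 = 0"
    using f(2,3) map_poly_of_rat_quadratic[OF c', of g' e'] by metis+
  have "(\<alpha> - \<beta>) * (of_rat c' * (\<alpha> + \<beta>) + of_rat e')
      = (of_rat g' + of_rat e' * \<alpha> + of_rat c' * \<alpha> ^ 2)
        - (of_rat g' + of_rat e' * \<beta> + of_rat c' * \<beta> ^ 2)"
    by (simp add: power2_eq_square algebra_simps)
  then have "(\<alpha> - \<beta>) * (of_rat c' * (\<alpha> + \<beta>) + of_rat e') = 0" by (simp only: roots diff_self)
  then have "of_rat e' = - (of_rat c' * (\<alpha> + \<beta>))" using neq by (simp add: add_eq_0_iff)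
  then have g': "of_rat g' = of_rat c' * (\<alpha> * \<beta>)"
    using roots(1) by (simp only:) (simp add: power2_eq_square algebra_simps)
  have "of_rat (c * e' - c' * e) * \<alpha> + of_rat (c * g' - c' * g)
      = of_rat c * (of_rat g' + of_rat e' * \<alpha> + of_rat c' * \<alpha> ^ 2)
        - of_rat c' * (of_rat c * \<alpha> ^ 2 + of_rat e * \<alpha> + of_rat g)"
    by (simp add: of_rat_diff of_rat_mult algebra_simps)
  also have "\<dots> = 0" by (simp only: roots root) simp
  finally have "c * g' - c' * g = 0" using rational_linear_relation_trivial[OF assms(1)] by blast
  then have "g / c = g' / c'" using assms(2) c' by (simp add: field_simps)
  then show "\<beta> \<noteq> \<alpha> \<and> \<alpha> * \<beta> = of_rat (g / c)" using neq c' by (simp add: of_rat_divide g')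
next
  assume \<beta>: "\<beta> \<noteq> \<alpha> \<and> \<alpha> * \<beta> = of_rat (g / c)"
  have "\<alpha> \<noteq> 0" using assms(1) range_eqI[of \<alpha> of_rat 0] by auto
  have g: "of_rat g = of_rat c * (\<alpha> * \<beta>)" using \<beta> assms(2) by (simp add: of_rat_divide)
  then have "\<alpha> * (of_rat c * (\<alpha> + \<beta>) + of_rat e) = 0"
    using root by (simp add: power2_eq_square algebra_simps)
  then have e: "of_rat e = - (of_rat c * (\<alpha> + \<beta>))"
    using \<open>\<alpha> \<noteq> 0\<close> by (simp add: add_eq_0_iff)
  have "poly [:g, e, c:] r \<noteq> 0" for r
  proof
    assume r: "poly [:g, e, c:] r = 0"
    have "(\<alpha> - of_rat r) * (of_rat c * \<alpha> + of_rat (c * r + e))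
        = (of_rat c * \<alpha> ^ 2 + of_rat e * \<alpha> + of_rat g) - of_rat (poly [:g, e, c:] r)"
      by (simp add: of_rat_add of_rat_mult power2_eq_square algebra_simps)
    then have "(\<alpha> - of_rat r) * (of_rat c * \<alpha> + of_rat (c * r + e)) = 0"
      by (simp only: r root of_rat_0 diff_self)
    moreover have "\<alpha> - of_rat r \<noteq> 0" using assms(1) by auto
    ultimately have "of_rat c * \<alpha> + of_rat (c * r + e) = 0" by simp
    then show False using rational_linear_relation_trivial[OF assms(1)] assms(2) by blast
  qed
  then have "irreducible [:g, e, c:]" by (intro irreducible_quadraticI) (use assms(2) in auto)
  moreover have "degree [:g, e, c:] = 2" using assms(2) by simp
  moreover have "poly (map_poly of_rat [:g, e, c:]) \<alpha> = 0" "poly (map_poly of_rat [:g, e, c:]) \<beta> = 0"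
    unfolding map_poly_of_rat_quadratic[OF assms(2)] g e
    by (simp_all add: power2_eq_square algebra_simps)
  ultimately show "quadratic_conjugate \<alpha> \<beta>" unfolding quadratic_conjugate_def using \<beta> by blast
qed

theorem theorem6:
  fixes \<alpha> :: "'p::prime_card padic" and k :: nat
  assumes "odd CARD('p)"
    and "browkin2_purely_periodic \<alpha> k"
  shows "padic_norm \<alpha> = 1 \<and>
    (\<exists>\<beta>. quadratic_conjugate \<alpha> \<beta>) \<and>
    (\<forall>\<beta>. quadratic_conjugate \<alpha> \<beta> \<longrightarrow> padic_norm \<beta> < 1)"
proof -
  have inf: "browkin2_infinite \<alpha>" and k: "k \<ge> 1"
    and per: "browkin2_coeff \<alpha> (n + k) = browkin2_coeff \<alpha> n" for n
    using assms(2) by (auto simp: browkin2_purely_periodic_def)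
  have p: "1 / real CARD('p) < 1" using pr_gt_1[where 'p='p] by simp
  \<comment> \<open>The twofold period is even, so a shift by it maps even steps to even steps.\<close>
  define k' where "k' = 2 * k"
  have k': "even k'" "k' > 0" using k by (simp_all add: k'_def)
  have per': "browkin2_coeff \<alpha> (n + k') = browkin2_coeff \<alpha> n" for n
    using per[of "n + k"] per[of n] by (simp add: k'_def mult_2 add.assoc)
  have quot_k': "browkin2_quot \<alpha> k' = \<alpha>"
    by (rule browkin2_quot_periodic[OF assms(1) inf k'(1) per'])
  then have norm: "padic_norm \<alpha> = 1" using padic_norm_even_quot[OF assms(1) inf k'] by simp
  obtain m where m: "k' = 2 * Suc m" using k by (cases k) (simp_all add: k'_def)
  obtain a b c d where
    "\<alpha> * (of_rat c * \<alpha> + of_rat d) = of_rat a * \<alpha> + of_rat b"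
    and norms: "padic_norm (of_rat b :: 'p padic) < padic_norm (of_rat a :: 'p padic)"
      "padic_norm (of_rat c :: 'p padic) = padic_norm (of_rat a :: 'p padic)"
    using browkin2_quot_moebius[OF assms(1) inf norm, of m] unfolding m[symmetric] quot_k' by blast
  then have root: "of_rat c * \<alpha> ^ 2 + of_rat (d - a) * \<alpha> + of_rat (- b) = 0"
    by (simp add: of_rat_diff of_rat_minus power2_eq_square algebra_simps)
  have c: "c \<noteq> 0" using norms padic_norm_nonneg[of "of_rat b :: 'p padic"] by auto
  have "\<alpha> \<notin> range of_rat" by (rule browkin2_infinite_imp_irrational[OF assms(1) inf])
  note conj_iff = quadratic_conjugate_of_irrational_root[OF this c root]
  \<comment> \<open>\<open>- b / c\<close> is the product of the two roots.\<close>
  have product: "padic_norm (of_rat (- b / c) :: 'p padic) < 1"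
  proof -
    have "padic_norm (of_rat (- b / c) :: 'p padic) * padic_norm (of_rat c :: 'p padic)
        = padic_norm (of_rat b :: 'p padic)"
      using c by (simp add: of_rat_divide of_rat_minus flip: padic_norm_mult)
    then show ?thesis
      using norms padic_norm_pos[of "of_rat c :: 'p padic"] c
        mult_right_mono[of 1 "padic_norm (of_rat (- b / c) :: 'p padic)" "padic_norm (of_rat c :: 'p padic)"]
      by (force simp: not_le[symmetric])
  qed
  have small: "padic_norm \<beta> < 1" if "\<alpha> * \<beta> = of_rat (- b / c)" for \<beta>
    using product norm unfolding that[symmetric] by (simp add: padic_norm_mult)
  have "\<alpha> \<noteq> 0" using norm by auto
  then have "\<alpha> * (of_rat (- b / c) / \<alpha>) = of_rat (- b / c)" by simp
  then have "quadratic_conjugate \<alpha> (of_rat (- b / c) / \<alpha>)"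
    using small norm unfolding conj_iff by fastforce
  then show ?thesis using norm small unfolding conj_iff by blast
qed

end
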